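(* Let $S\subset\mathbb{R}^n$ be a set of diameter $d>0$. (1) If $S$ is a smooth body or centrally symmetric, then for every positive integer $k$, we have $a_k(S)\le a_k(\mathbf{B}^n)$. (2) If $S$ is a convex body of constant width, then for every positive integer $k$, we have $a_k(S)\ge a_k(\mathbf{B}^n)$. (3) For every positive integer $k$, we have $a_k(\mathbf{B}^n)=2k+n-1$.
   Context: $\mathbf{B}^n$ denotes the closed Euclidean unit ball of $\mathbb{R}^n$ centered at the origin. For a set $S\subset\mathbb{R}^n$ of diameter $d>0$ (finite) and a positive integer $k$, the $k$-fold Borsuk number $a_k(S)$ is the smallest positive integer $m$ such that there is a $k$-fold cover of $S$ with $m$ sets of diameters strictly less than $d$. A $k$-fold cover of $S$ is a family of sets such that any point of $S$ belongs to at least $k$ members of the family; some members of the family are permitted to coincide (they are counted with multiplicity). A set $S\subset\mathbb{R}^n$ is called a smooth body if $S$ is homeomorphic to $\mathbf{B}^n$ and its boundary is a $C^1$-class submanifold of $\mathbb{R}^n$. A convex body is a compact convex set with nonempty interior; it has constant width if the distance between any two of its parallel supporting hyperplanes is the same. *)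

theory Defs
  imports "HOL-Analysis.Analysis"
begin

text \<open>The family is indexed by \<open>{..<m}\<close>, so repeated members count with multiplicity. The members
  need not be subsets of \<open>S\<close>.\<close>

definition k_fold_cover :: "nat \<Rightarrow> 'a set \<Rightarrow> nat \<Rightarrow> (nat \<Rightarrow> 'a set) \<Rightarrow> bool" where
  "k_fold_cover k S m F \<longleftrightarrow> (\<forall>x\<in>S. k \<le> card {i\<in>{..<m}. x \<in> F i})"

text \<open>Meaningful for bounded \<open>S\<close> with \<open>diameter S > 0\<close>. Boundedness of the members is required
  explicitly because \<^const>\<open>diameter\<close> has no useful value on unbounded sets.\<close>

definition borsuk_number :: "nat \<Rightarrow> 'a::metric_space set \<Rightarrow> nat" where
  "borsuk_number k S =
     (LEAST m. 0 < m \<and>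
        (\<exists>F. k_fold_cover k S m F \<and> (\<forall>i<m. bounded (F i) \<and> diameter (F i) < diameter S)))"

definition C1_on :: "'a::euclidean_space set \<Rightarrow> ('a \<Rightarrow> 'b::euclidean_space) \<Rightarrow> bool" where
  "C1_on U f \<longleftrightarrow>
     (\<exists>f' :: 'a \<Rightarrow> 'a \<Rightarrow>\<^sub>L 'b.
        (\<forall>x\<in>U. (f has_derivative blinfun_apply (f' x)) (at x)) \<and> continuous_on U f')"

definition C1_submanifold :: "'a::euclidean_space set \<Rightarrow> bool" where
  "C1_submanifold M \<longleftrightarrow>
     (\<exists>m. \<forall>p\<in>M. \<exists>U V (\<phi> :: 'a \<Rightarrow> 'a) \<psi> T.
        open U \<and> p \<in> U \<and> open V \<and> homeomorphism U V \<phi> \<psi> \<and> C1_on U \<phi> \<and> C1_on V \<psi> \<and>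
        subspace T \<and> dim T = m \<and> \<phi> ` (M \<inter> U) = T \<inter> V)"

definition smooth_body :: "'a::euclidean_space set \<Rightarrow> bool" where
  "smooth_body S \<longleftrightarrow> S homeomorphic (cball 0 1 :: 'a set) \<and> C1_submanifold (frontier S)"

definition centrally_symmetric :: "'a::real_vector set \<Rightarrow> bool" where
  "centrally_symmetric S \<longleftrightarrow> (\<exists>c. (\<lambda>x. 2 *\<^sub>R c - x) ` S = S)"

definition convex_body :: "'a::euclidean_space set \<Rightarrow> bool" where
  "convex_body S \<longleftrightarrow> compact S \<and> convex S \<and> interior S \<noteq> {}"

definition supporting_hyperplane :: "'a::euclidean_space set \<Rightarrow> 'a set \<Rightarrow> bool" where
  "supporting_hyperplane S H \<longleftrightarrow>
     (\<exists>u b. u \<noteq> 0 \<and> H = {x. u \<bullet> x = b} \<and> S \<inter> H \<noteq> {} \<and> (\<forall>x\<in>S. u \<bullet> x \<le> b))"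

definition constant_width :: "'a::euclidean_space set \<Rightarrow> bool" where
  "constant_width S \<longleftrightarrow>
     (\<exists>w. \<forall>H1 H2. supporting_hyperplane S H1 \<and> supporting_hyperplane S H2 \<and>
        H1 \<noteq> H2 \<and> (\<exists>v. H2 = (+) v ` H1) \<longrightarrow> setdist H1 H2 = w)"

end

theory Submission
  imports Defs "HOL-Homology.Homology" "HOL-Computational_Algebra.Polynomial"
begin

text \<open>
  Everything is reduced to the value \<open>2 k + n - 1\<close>. It is a lower bound for every set that receives a
  continuous map \<open>p\<close> from the unit sphere carrying antipodal points to points at distance (at least)
  the diameter, and an upper bound for every bounded set whose closure contains, for each of its
  points, at most one point at distance the diameter.

  Lower bound. Suppose \<open>m\<close> sets of diameter smaller than \<open>d\<close> cover the image of \<open>p\<close> \<open>k\<close>-fold. Pulled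
  back to the sphere, their closures contain no antipodal pair. Apply the Borsuk-Ulam theorem to the
  distance functions from the first \<open>n - 1\<close> pullbacks: some \<open>u\<close> has the same distances as \<open>- u\<close>, so
  neither point lies in any of these sets. Hence \<open>u\<close> and \<open>- u\<close> are each in at least \<open>k\<close> of the remaining
  \<open>m - (n - 1)\<close> sets, with disjoint index sets, and \<open>2 k \<le> m - (n - 1)\<close>
  (\<open>multifold_lusternik_schnirelmann\<close>). For the ball \<open>p\<close> is the identity. In a body of constant width
  \<open>w\<close> opposite support points differ by exactly \<open>w\<close> times the unit normal, so the support point in a
  direction is unique, depends continuously on the direction, and gives the map \<open>p\<close>
  (\<open>constant_width_support_points\<close>).

  Upper bound. By Gale's lemma there are \<open>2 k + n - 1\<close> vectors such that every open hemisphere contains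
  at least \<open>k\<close> of them; points on the moment curve with alternating signs work. By compactness the
  open half spaces may be replaced by closed caps that contain no antipodal points
  (\<open>gale_closed_caps\<close>). If each point of a compact set \<open>S\<close> has at most one partner at distance
  \<open>diameter S\<close>, the direction to the partner is a continuous map from the points having a partner to
  the sphere, and partners have opposite directions. The preimages of the caps therefore have
  diameter smaller than that of \<open>S\<close>; thickened slightly, and enlarged by all points far from the
  points having a partner, they cover \<open>S\<close> (\<open>unique_partner_cover\<close>). Partners are unique in a centrally
  symmetric set, where they are opposite with respect to the center, and in a smooth body, where the
  tangent hyperplane at a boundary point determines the direction to its partner.

  The Borsuk-Ulam theorem is derived from the statement that odd self-maps of spheres have odd degree
  (\<open>odd_flag_degree\<close>). Its proof is an induction on the dimension; the homological input is
  the congruence \<open>Borsuk_odd_mapping_degree_step\<close> for odd maps preserving the equator, and the work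
  lies in deforming an arbitrary odd map, after a change of coordinates, to an odd map that preserves
  the equator.
\<close>

section \<open>Coordinate spheres and their degrees\<close>

text \<open>Brouwer degrees are defined for self-maps of \<open>nsphere m\<close>, a space of sequences, whereas
approximation by polynomials and negligible sets live in Euclidean spaces. The linear coordinates
below identify \<open>nsphere m\<close>, for all \<open>m < DIM('a)\<close> at once, with the unit spheres of an
increasing chain of coordinate subspaces of one fixed Euclidean space, so that the equator of each sphere is the
next smaller one.\<close>

definition basis_enum :: "nat \<Rightarrow> 'a::euclidean_space" where
  "basis_enum = (SOME b. bij_betw b {..<DIM('a)} Basis)"

lemma bij_betw_basis_enum: "bij_betw (basis_enum :: nat \<Rightarrow> 'a::euclidean_space) {..<DIM('a)} Basis"
proof -
  have "\<exists>b. bij_betw b {..<DIM('a)} (Basis :: 'a set)"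
    using ex_bij_betw_nat_finite[of "Basis :: 'a set"] by (auto simp: atLeast0LessThan)
  then show ?thesis
    unfolding basis_enum_def by (rule someI_ex)
qed

lemma basis_enum_in_Basis: "i < DIM('a) \<Longrightarrow> (basis_enum i :: 'a::euclidean_space) \<in> Basis"
  using bij_betw_basis_enum bij_betwE by blast

lemma basis_enum_eq_iff:
  "i < DIM('a) \<Longrightarrow> j < DIM('a) \<Longrightarrow> (basis_enum i :: 'a::euclidean_space) = basis_enum j \<longleftrightarrow> i = j"
  using bij_betw_basis_enum[where 'a='a] by (auto simp: bij_betw_def inj_on_def)

lemma inner_basis_enum:
  "i < DIM('a) \<Longrightarrow> j < DIM('a) \<Longrightarrow>
   (basis_enum i :: 'a::euclidean_space) \<bullet> basis_enum j = (if i = j then 1 else 0)"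
  using basis_enum_eq_iff[where 'a='a] basis_enum_in_Basis[where 'a='a] by (auto simp: inner_Basis)

definition of_coords :: "(nat \<Rightarrow> real) \<Rightarrow> 'a::euclidean_space" where
  "of_coords x = (\<Sum>i<DIM('a). x i *\<^sub>R basis_enum i)"

definition coords :: "'a::euclidean_space \<Rightarrow> nat \<Rightarrow> real" where
  "coords y = (\<lambda>i. if i < DIM('a) then y \<bullet> basis_enum i else 0)"

definition flag :: "nat \<Rightarrow> 'a::euclidean_space set" where
  "flag m = {y. \<forall>i>m. coords y i = 0}"

abbreviation flag_sphere :: "nat \<Rightarrow> 'a::euclidean_space set" where
  "flag_sphere m \<equiv> sphere 0 1 \<inter> flag m"

lemma coords_of_coords:
  assumes "\<forall>i\<ge>DIM('a). x i = 0"
  shows "coords (of_coords x :: 'a::euclidean_space) = x"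
proof
  fix j
  show "coords (of_coords x :: 'a) j = x j"
  proof (cases "j < DIM('a)")
    case True
    have "coords (of_coords x :: 'a) j = (\<Sum>i<DIM('a). x i * ((basis_enum i :: 'a) \<bullet> basis_enum j))"
      using True by (simp add: coords_def of_coords_def inner_sum_left)
    also have "\<dots> = (\<Sum>i<DIM('a). if i = j then x i else 0)"
      using True by (intro sum.cong) (auto simp: inner_basis_enum)
    also have "\<dots> = x j" using True by simp
    finally show ?thesis .
  qed (use assms in \<open>simp add: coords_def\<close>)
qed

lemma sum_basis_enum: "(\<Sum>i<DIM('a). f (basis_enum i :: 'a::euclidean_space)) = sum f Basis"
  by (rule sum.reindex_bij_betw[OF bij_betw_basis_enum])

lemma of_coords_coords: "of_coords (coords y) = (y :: 'a::euclidean_space)"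
proof -
  have "(of_coords (coords y) :: 'a) = (\<Sum>i<DIM('a). (y \<bullet> basis_enum i) *\<^sub>R basis_enum i)"
    by (simp add: of_coords_def coords_def)
  also have "\<dots> = y"
    using sum_basis_enum[of "\<lambda>b. (y \<bullet> b) *\<^sub>R b"] by (simp add: euclidean_representation)
  finally show ?thesis .
qed

lemma norm_coords: "(norm (y :: 'a::euclidean_space))\<^sup>2 = (\<Sum>i<DIM('a). (coords y i)\<^sup>2)"
proof -
  have "(norm y)\<^sup>2 = (\<Sum>b\<in>Basis. (y \<bullet> b)\<^sup>2)"
    by (simp add: norm_eq_sqrt_inner euclidean_inner[of y y] power2_eq_square sum_nonneg)
  also have "\<dots> = (\<Sum>i<DIM('a). (coords y i)\<^sup>2)"
    by (simp add: sum_basis_enum[symmetric] coords_def)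
  finally show ?thesis .
qed

lemma coords_minus: "coords (- y) = (\<lambda>i. - coords y i)"
  by (auto simp: coords_def)

lemma of_coords_minus: "of_coords (\<lambda>i. - x i) = - of_coords x"
  by (simp add: of_coords_def sum_negf)

lemma subspace_flag: "subspace (flag m)"
  by (auto simp: flag_def coords_def subspace_def inner_add_left)

lemma flag_mono: "m \<le> n \<Longrightarrow> flag m \<subseteq> flag n"
  by (auto simp: flag_def)

lemma dim_flag:
  assumes "m < DIM('a)"
  shows "dim (flag m :: 'a::euclidean_space set) = Suc m"
proof -
  let ?b = "basis_enum :: nat \<Rightarrow> 'a"
  have B: "(Basis :: 'a set) = ?b ` {..<DIM('a)}"
    using bij_betw_basis_enum[where 'a='a] by (simp add: bij_betw_def)
  have *: "(flag m :: 'a set) = {x. \<forall>i\<in>Basis. i \<notin> ?b ` {..m} \<longrightarrow> x \<bullet> i = 0}"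
  proof -
    have low: "?b i \<notin> ?b ` {..m} \<longleftrightarrow> m < i" if "i < DIM('a)" for i
      using assms that by (auto simp: basis_enum_eq_iff image_iff Bex_def)
    have "y \<in> flag m \<longleftrightarrow> (\<forall>i\<in>{..<DIM('a)}. ?b i \<notin> ?b ` {..m} \<longrightarrow> y \<bullet> ?b i = 0)" for y :: 'a
      using low by (auto simp: flag_def coords_def)
    moreover have "(\<forall>i\<in>Basis. P i) \<longleftrightarrow> (\<forall>i\<in>{..<DIM('a)}. P (?b i))" for P
      using arg_cong[OF B, of "\<lambda>A. Ball A P"] by (simp only: ball_simps)
    ultimately show ?thesis by (simp only: set_eq_iff mem_Collect_eq simp_thms)
  qed
  have "?b ` {..m} \<subseteq> Basis"
    using assms by (auto intro!: basis_enum_in_Basis)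
  moreover have "inj_on ?b {..m}"
    using assms by (auto simp: inj_on_def basis_enum_eq_iff)
  ultimately show ?thesis
    unfolding * by (simp add: dim_substandard card_image)
qed

lemma in_flag_sphere_iff:
  assumes "m < DIM('a)"
  shows "(y :: 'a::euclidean_space) \<in> flag_sphere m \<longleftrightarrow> coords y \<in> topspace (nsphere m)"
proof -
  have "(\<Sum>i<DIM('a). (coords y i)\<^sup>2) = (\<Sum>i\<le>m. (coords y i)\<^sup>2)" if "\<forall>i>m. coords y i = 0"
    using assms that by (intro sum.mono_neutral_right) auto
  moreover have "norm y = 1 \<longleftrightarrow> (norm y)\<^sup>2 = 1"
    by (simp add: power2_eq_1_iff) (metis norm_ge_zero neg_0_le_iff_le not_one_le_zero)
  ultimately show ?thesis
    by (auto simp: flag_def nsphere norm_coords)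
qed

lemma coords_of_coords_nsphere:
  "m < DIM('a) \<Longrightarrow> x \<in> topspace (nsphere m) \<Longrightarrow> coords (of_coords x :: 'a::euclidean_space) = x"
  by (intro coords_of_coords) (auto simp: nsphere)

lemma of_coords_in_flag_sphere:
  "m < DIM('a) \<Longrightarrow> x \<in> topspace (nsphere m) \<Longrightarrow> (of_coords x :: 'a::euclidean_space) \<in> flag_sphere m"
  by (simp only: in_flag_sphere_iff coords_of_coords_nsphere)

lemma continuous_map_of_coords:
  assumes "m < DIM('a)"
  shows "continuous_map (nsphere m) (top_of_set (flag_sphere m :: 'a::euclidean_space set)) of_coords"
proof -
  have "continuous_map (nsphere m) euclidean (of_coords :: _ \<Rightarrow> 'a)"
    unfolding of_coords_def
  proof (intro continuous_map_sum)
    fix i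
    have "continuous_map euclideanreal euclidean (\<lambda>r. r *\<^sub>R (basis_enum i :: 'a))"
      by (auto intro!: continuous_intros)
    from continuous_map_compose[OF continuous_map_nsphere_projection this]
    show "continuous_map (nsphere m) euclidean (\<lambda>x. x i *\<^sub>R (basis_enum i :: 'a))"
      by (simp add: o_def)
  qed auto
  then show ?thesis
    using of_coords_in_flag_sphere[OF assms] by (auto simp: continuous_map_in_subtopology simp del: Int_iff)
qed

lemma continuous_map_coords:
  assumes "m < DIM('a)"
  shows "continuous_map (top_of_set (flag_sphere m :: 'a::euclidean_space set)) (nsphere m) coords"
proof -
  have "continuous_map (top_of_set (flag_sphere m :: 'a set)) euclideanreal (\<lambda>y. coords y i)" for i
    unfolding coords_def by (cases "i < DIM('a)") (auto intro!: continuous_intros)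
  moreover have "coords y \<in> {x. (\<Sum>i\<le>m. x i ^ 2) = 1 \<and> (\<forall>i>m. x i = 0)}" if "y \<in> flag_sphere m" for y :: 'a
    using in_flag_sphere_iff[OF assms, of y] that by (simp add: nsphere)
  ultimately show ?thesis
    unfolding nsphere continuous_map_in_subtopology continuous_map_componentwise_UNIV
    by (auto simp del: Int_iff mem_Collect_eq)
qed

text \<open>The degree of a self-map of the unit \<open>m\<close>-sphere in the coordinate subspace \<open>flag m\<close>.\<close>

definition flag_degree :: "nat \<Rightarrow> ('a::euclidean_space \<Rightarrow> 'a) \<Rightarrow> int" where
  "flag_degree m f = Brouwer_degree2 m (coords \<circ> f \<circ> of_coords)"

lemma continuous_map_conj:
  fixes f :: "'a::euclidean_space \<Rightarrow> 'a"
  assumes m: "m < DIM('a)" and f: "continuous_on (flag_sphere m) f" "f \<in> flag_sphere m \<rightarrow> flag_sphere m"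
  shows "continuous_map (nsphere m) (nsphere m) (coords \<circ> f \<circ> of_coords)"
proof -
  have "continuous_map (top_of_set (flag_sphere m)) (top_of_set (flag_sphere m)) f"
    using f by (simp add: continuous_map_subtopology_eu Pi_iff image_subset_iff)
  then show ?thesis
    using continuous_map_of_coords[OF m] continuous_map_coords[OF m]
    by (intro continuous_map_compose)
qed

text \<open>Maps that are nowhere antipodal are joined by the segment homotopy, pushed back radially to the
sphere.\<close>

lemma flag_degree_homotopic:
  fixes f g :: "'a::euclidean_space \<Rightarrow> 'a"
  assumes m: "m < DIM('a)"
    and f: "continuous_on (flag_sphere m) f" "f \<in> flag_sphere m \<rightarrow> flag_sphere m"
    and g: "continuous_on (flag_sphere m) g" "g \<in> flag_sphere m \<rightarrow> flag_sphere m"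
    and ne: "\<And>x. x \<in> flag_sphere m \<Longrightarrow> f x \<noteq> - g x"
  shows "flag_degree m f = flag_degree m g"
proof -
  let ?S = "flag_sphere m :: 'a set"
  define nz where "nz = (\<lambda>x::'a. x /\<^sub>R norm x)"
  have seg: "closed_segment (f x) (g x) \<subseteq> flag m - {0}" if "x \<in> ?S" for x
  proof -
    have fx: "f x \<in> ?S" and gx: "g x \<in> ?S"
      using f(2) g(2) that by blast+
    have "0 \<notin> closed_segment (f x) (g x)"
    proof
      assume "0 \<in> closed_segment (f x) (g x)"
      then obtain t where "0 \<le> t" "t \<le> 1" "(1 - t) *\<^sub>R f x + t *\<^sub>R g x = 0"
        by (auto simp: in_segment)
      have eq: "(1 - t) *\<^sub>R f x = - (t *\<^sub>R g x)"
        using \<open>(1 - t) *\<^sub>R f x + t *\<^sub>R g x = 0\<close> by (simp add: eq_neg_iff_add_eq_0)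
      then have "norm ((1 - t) *\<^sub>R f x) = norm (t *\<^sub>R g x)"
        by simp
      then have t: "t = 1/2"
        using fx gx \<open>0 \<le> t\<close> \<open>t \<le> 1\<close> by simp
      have "f x = - g x"
        using eq scaleR_cancel_left[of "1/2" "f x" "- g x"] unfolding t by simp
      then show False using ne that by blast
    qed
    moreover have "closed_segment (f x) (g x) \<subseteq> flag m"
      using fx gx subspace_imp_convex[OF subspace_flag] by (intro closed_segment_subset) auto
    ultimately show ?thesis by blast
  qed
  have "homotopic_with_canon (\<lambda>z. True) ?S (flag m - {0}) f g"
    using f(1) g(1) seg by (rule homotopic_with_linear)
  moreover have "continuous_map (top_of_set (flag m - {0})) (top_of_set ?S) nz"
  proof -
    have "nz x \<in> ?S" if "x \<in> flag m - {0}" for x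
      using that subspace_scale[OF subspace_flag] by (auto simp: nz_def)
    then show ?thesis
      unfolding nz_def by (auto simp: continuous_map_subtopology_eu intro!: continuous_intros)
  qed
  ultimately have "homotopic_with_canon (\<lambda>z. True) ?S ?S (nz \<circ> f) (nz \<circ> g)"
    by (rule homotopic_with_compose_continuous_map_left) auto
  then have "homotopic_with (\<lambda>z. True) (top_of_set ?S) (nsphere m) (coords \<circ> (nz \<circ> f)) (coords \<circ> (nz \<circ> g))"
    by (rule homotopic_with_compose_continuous_map_left[OF _ continuous_map_coords[OF m]]) auto
  then have "homotopic_with (\<lambda>z. True) (nsphere m) (nsphere m)
      (coords \<circ> (nz \<circ> f) \<circ> of_coords) (coords \<circ> (nz \<circ> g) \<circ> of_coords)"
    by (rule homotopic_with_compose_continuous_map_right[OF _ continuous_map_of_coords[OF m]]) auto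
  then have "flag_degree m (nz \<circ> f) = flag_degree m (nz \<circ> g)"
    unfolding flag_degree_def by (rule Brouwer_degree2_homotopic)
  moreover have "nz (h x) = h x" if "h \<in> ?S \<rightarrow> ?S" "x \<in> ?S" for h x
    using that by (auto simp: nz_def Pi_iff)
  then have "flag_degree m (nz \<circ> h) = flag_degree m h" if "h \<in> ?S \<rightarrow> ?S" for h
    unfolding flag_degree_def using that of_coords_in_flag_sphere[OF m]
    by (intro Brouwer_degree2_eq) (auto simp del: Int_iff)
  ultimately show ?thesis using f g by simp
qed

lemma flag_degree_compose:
  fixes f g :: "'a::euclidean_space \<Rightarrow> 'a"
  assumes m: "m < DIM('a)"
    and f: "continuous_on (flag_sphere m) f" "f \<in> flag_sphere m \<rightarrow> flag_sphere m"
    and g: "continuous_on (flag_sphere m) g" "g \<in> flag_sphere m \<rightarrow> flag_sphere m"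
  shows "flag_degree m (g \<circ> f) = flag_degree m g * flag_degree m f"
proof -
  have "coords \<circ> (g \<circ> f) \<circ> of_coords = (coords \<circ> g \<circ> of_coords) \<circ> (coords \<circ> f \<circ> of_coords)"
    by (simp add: fun_eq_iff of_coords_coords)
  then show ?thesis
    unfolding flag_degree_def
    by (simp only: Brouwer_degree2_compose[OF continuous_map_conj[OF m f] continuous_map_conj[OF m g]])
qed

lemma flag_degree_step:
  fixes f :: "'a::euclidean_space \<Rightarrow> 'a"
  assumes m: "Suc m < DIM('a)"
    and f: "continuous_on (flag_sphere (Suc m)) f" "f \<in> flag_sphere (Suc m) \<rightarrow> flag_sphere (Suc m)"
    and fm: "f \<in> flag_sphere m \<rightarrow> flag_sphere m"
    and odd: "\<And>x. x \<in> flag_sphere (Suc m) \<Longrightarrow> f (- x) = - f x"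
  shows "even (flag_degree (Suc m) f - flag_degree m f)"
proof -
  have "even (Brouwer_degree2 (Suc m) (coords \<circ> f \<circ> of_coords)
    - Brouwer_degree2 (Suc m - Suc 0) (coords \<circ> f \<circ> of_coords))"
  proof (rule Borsuk_odd_mapping_degree_step)
    show "continuous_map (nsphere (Suc m)) (nsphere (Suc m)) (coords \<circ> f \<circ> of_coords)"
      by (rule continuous_map_conj[OF m f])
    show "(coords \<circ> f \<circ> of_coords \<circ> (\<lambda>x i. - x i)) u = ((\<lambda>x i. - x i) \<circ> (coords \<circ> f \<circ> of_coords)) u"
      if "u \<in> topspace (nsphere (Suc m))" for u
      using odd[OF of_coords_in_flag_sphere[OF m that]]
      by (simp add: of_coords_minus coords_minus)
    show "coords \<circ> f \<circ> of_coords \<in> topspace (nsphere (Suc m - Suc 0)) \<rightarrow> topspace (nsphere (Suc m - Suc 0))"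
      using fm m of_coords_in_flag_sphere[of m, where 'a='a] in_flag_sphere_iff[of m, where 'a='a]
      by (auto simp del: Int_iff simp: Pi_iff)
  qed
  then show ?thesis by (simp add: flag_degree_def)
qed

text \<open>The zero-dimensional sphere is a pair of points, whose only odd self-maps are the identity and the
swap, of degree \<open>1\<close> and \<open>- 1\<close>.\<close>

lemma odd_flag_degree_0:
  fixes f :: "'a::euclidean_space \<Rightarrow> 'a"
  assumes fm: "f \<in> flag_sphere 0 \<rightarrow> flag_sphere 0"
    and f_odd: "\<And>x. x \<in> flag_sphere 0 \<Longrightarrow> f (- x) = - f x"
  shows "odd (flag_degree 0 f)"
proof -
  let ?g = "coords \<circ> f \<circ> of_coords"
  let ?p = "\<lambda>i::nat. if i = 0 then 1 else 0 :: real"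
  have sph: "x \<in> topspace (nsphere 0) \<longleftrightarrow> x = ?p \<or> x = (\<lambda>i. - ?p i)" for x
    by (auto simp: nsphere fun_eq_iff power2_eq_1_iff)
  have g: "?g x \<in> topspace (nsphere 0)" if "x \<in> topspace (nsphere 0)" for x
    using fm of_coords_in_flag_sphere[of 0, where 'a='a] in_flag_sphere_iff[of 0, where 'a='a] that
    by (auto simp del: Int_iff simp: Pi_iff)
  have gm: "?g (\<lambda>i. - x i) = (\<lambda>i. - ?g x i)" if "x \<in> topspace (nsphere 0)" for x
    using f_odd[OF of_coords_in_flag_sphere[OF _ that]] by (simp add: of_coords_minus coords_minus)
  have p: "?p \<in> topspace (nsphere 0)"
    by (simp add: sph)
  from g[OF p] consider "?g ?p = ?p" | "?g ?p = (\<lambda>i. - ?p i)"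
    unfolding sph by blast
  then show ?thesis
  proof cases
    case 1
    have "?g x = id x" if "x \<in> topspace (nsphere 0)" for x
      using that[unfolded sph]
    proof
      assume "x = ?p"
      with 1 show ?thesis by (simp only: id_apply)
    next
      assume "x = (\<lambda>i. - ?p i)"
      with gm[OF p] 1 show ?thesis by (simp only: id_apply)
    qed
    then have "flag_degree 0 f = Brouwer_degree2 0 id"
      unfolding flag_degree_def by (rule Brouwer_degree2_eq)
    then show ?thesis by simp
  next
    case 2
    have r: "(\<lambda>i. - ?p i) = (\<lambda>i. if i = 0 then - ?p i else ?p i)" by auto
    have "?g x = (\<lambda>i. if i = 0 then - x i else x i)" if "x \<in> topspace (nsphere 0)" for x
      using that[unfolded sph]
    proof
      assume "x = ?p"
      with 2 show ?thesis by (simp only: r)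
    next
      assume x: "x = (\<lambda>i. - ?p i)"
      with gm[OF p] 2 have "?g x = (\<lambda>i. - (- ?p i))" by (simp only:)
      with x show ?thesis by (simp add: fun_eq_iff)
    qed
    then have "flag_degree 0 f = Brouwer_degree2 0 (\<lambda>x i. if i = 0 then - x i else x i)"
      unfolding flag_degree_def by (rule Brouwer_degree2_eq)
    then show ?thesis by (simp add: Brouwer_degree2_reflection)
  qed
qed

section \<open>Odd maps and the Borsuk-Ulam theorem\<close>

text \<open>The reflection in the hyperplane orthogonal to \<open>c - e\<close>; for vectors of equal norm it exchanges \<open>c\<close> and
\<open>e\<close>. For \<open>c = e\<close> division by zero makes it the identity.\<close>

definition swap_reflection :: "'a::real_inner \<Rightarrow> 'a \<Rightarrow> 'a \<Rightarrow> 'a" where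
  "swap_reflection c e x = x - (2 * (x \<bullet> (c - e)) / ((c - e) \<bullet> (c - e))) *\<^sub>R (c - e)"

lemma linear_swap_reflection: "linear (swap_reflection c e)"
proof -
  have "linear (\<lambda>x. x - (2 * (x \<bullet> u) / (u \<bullet> u)) *\<^sub>R u)" for u :: 'a
    by (rule linearI) (simp_all add: inner_add_left algebra_simps add_divide_distrib flip: scaleR_add_left)
  then show ?thesis unfolding swap_reflection_def .
qed

lemma norm_swap_reflection: "norm (swap_reflection c e x) = norm x"
proof (cases "c = e")
  case False
  define u where "u = c - e"
  define t where "t = 2 * (x \<bullet> u) / (u \<bullet> u)"
  have "u \<bullet> u \<noteq> 0" using False by (simp add: u_def)
  then have t: "t * (u \<bullet> u) = 2 * (x \<bullet> u)" by (simp add: t_def)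
  have "(x - t *\<^sub>R u) \<bullet> (x - t *\<^sub>R u) = x \<bullet> x - 2 * t * (x \<bullet> u) + t * (t * (u \<bullet> u))"
    by (simp add: inner_diff_left inner_diff_right inner_commute algebra_simps)
  also have "\<dots> = x \<bullet> x" unfolding t by simp
  finally show ?thesis
    by (simp add: swap_reflection_def u_def t_def norm_eq_sqrt_inner)
qed (simp add: swap_reflection_def)

lemma swap_reflection_swaps:
  assumes "norm c = norm e"
  shows "swap_reflection c e c = e"
proof (cases "c = e")
  case False
  have ce: "c \<bullet> c = e \<bullet> e" using assms by (simp add: norm_eq)
  have "2 * (c \<bullet> (c - e)) = (c - e) \<bullet> (c - e)"
    using ce by (simp add: inner_diff_left inner_diff_right inner_commute)
  then have one: "2 * (c \<bullet> (c - e)) / ((c - e) \<bullet> (c - e)) = 1"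
    using False by (metis divide_self inner_eq_zero_iff right_minus_eq)
  show ?thesis unfolding swap_reflection_def one by simp
qed (simp add: swap_reflection_def)

text \<open>Averaging a polynomial approximation \<open>p\<close> of an odd map with its reflection \<open>- p (- x)\<close> does not
increase the error.\<close>

lemma odd_polynomial_approximation:
  fixes f :: "'a::euclidean_space \<Rightarrow> 'a"
  assumes K: "compact K" "\<And>x. x \<in> K \<Longrightarrow> - x \<in> K"
    and f: "continuous_on K f" "\<And>x. x \<in> K \<Longrightarrow> f (- x) = - f x"
    and T: "subspace T" "f ` K \<subseteq> T" and "0 < \<epsilon>"
  obtains q where "q differentiable_on UNIV" "\<And>x. q (- x) = - q x" "q ` K \<subseteq> T"
    "\<And>x. x \<in> K \<Longrightarrow> norm (f x - q x) < \<epsilon>"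
proof -
  obtain p where p: "polynomial_function p" "p ` K \<subseteq> T" "\<And>x. x \<in> K \<Longrightarrow> norm (f x - p x) < \<epsilon>"
    using Stone_Weierstrass_polynomial_function_subspace[OF K(1) f(1) \<open>0 < \<epsilon>\<close> T] by blast
  define q where "q = (\<lambda>x. (1/2) *\<^sub>R (p x - p (- x)))"
  have dp: "p differentiable_on S" for S
    using p(1) by (rule differentiable_on_polynomial_function)
  have "(\<lambda>x. p (- x)) differentiable_on UNIV"
    by (rule differentiable_on_compose[of uminus UNIV p]) (auto intro: dp derivative_intros)
  then have "q differentiable_on UNIV"
    unfolding q_def by (intro derivative_intros differentiable_on_diff dp differentiable_on_scaleR) auto
  moreover have "q (- x) = - q x" for x
    by (simp add: q_def algebra_simps)
  moreover have "q ` K \<subseteq> T"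
    using p(2) K(2) T(1) by (auto simp: q_def image_subset_iff intro!: subspace_scale subspace_diff)
  moreover have "norm (f x - q x) < \<epsilon>" if "x \<in> K" for x
  proof -
    have "f x - q x = (1/2) *\<^sub>R (f x - p x) - (1/2) *\<^sub>R (f (- x) - p (- x))"
      using f(2)[OF that] by (simp add: q_def algebra_simps flip: scaleR_add_left)
    then have "norm (f x - q x) \<le> norm ((1/2) *\<^sub>R (f x - p x)) + norm ((1/2) *\<^sub>R (f (- x) - p (- x)))"
      by (simp only: norm_triangle_ineq4)
    also have "\<dots> < \<epsilon>"
      using p(3)[OF that] p(3)[OF K(2)[OF that]] by simp
    finally show ?thesis .
  qed
  ultimately show ?thesis by (rule that)
qed

lemma compact_flag_sphere: "compact (flag_sphere m :: 'a::euclidean_space set)"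
  by (intro compact_Int_closed closed_subspace subspace_flag) simp

lemma uminus_flag_sphere: "x \<in> flag_sphere m \<Longrightarrow> - x \<in> flag_sphere m"
  using subspace_neg[OF subspace_flag] by auto

lemma flag_sphere_mono: "m \<le> n \<Longrightarrow> flag_sphere m \<subseteq> flag_sphere n"
  using flag_mono by blast

lemma basis_enum_in_flag_sphere:
  "m < DIM('a) \<Longrightarrow> (basis_enum m :: 'a::euclidean_space) \<in> flag_sphere m"
  using basis_enum_in_Basis[of m, where 'a='a] by (auto simp: flag_def coords_def inner_basis_enum)

lemma flag_Suc_inner_zero:
  assumes "y \<in> flag (Suc m)" "Suc m < DIM('a)" "(y :: 'a::euclidean_space) \<bullet> basis_enum (Suc m) = 0"
  shows "y \<in> flag m"
  using assms by (auto simp: flag_def coords_def) (metis Suc_lessI)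

text \<open>Three modifications within the odd maps lead to a map preserving the equator, to which the degree
congruence and the induction hypothesis apply. A polynomial approximation makes the
map differentiable, so the image of the lower-dimensional equator omits a point \<open>c\<close> and, by oddness,
\<open>- c\<close>. Composing with a reflection moves \<open>c\<close> to the pole; this multiplies the degree by an integer,
which is harmless because a product is odd only if its factors are. Finally the
image of the equator, which stays away from both poles, is pushed onto the equator.\<close>

lemma odd_flag_degree:
  fixes f :: "'a::euclidean_space \<Rightarrow> 'a"
  assumes "m < DIM('a)"
    and "continuous_on (flag_sphere m) f" "f \<in> flag_sphere m \<rightarrow> flag_sphere m"
    and "\<And>x. x \<in> flag_sphere m \<Longrightarrow> f (- x) = - f x"
  shows "odd (flag_degree m f)"
  using assms
proof (induction m arbitrary: f)
  case 0
  then show ?case by (intro odd_flag_degree_0) auto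
next
  case (Suc m)
  note m = \<open>Suc m < DIM('a)\<close>
  let ?U = "flag_sphere (Suc m) :: 'a set" and ?W = "flag_sphere m :: 'a set"
  let ?e = "basis_enum (Suc m) :: 'a"
  have WU: "?W \<subseteq> ?U" by (rule flag_sphere_mono) simp
  have neg: "- x \<in> ?U" if "x \<in> ?U" for x using that by (rule uminus_flag_sphere)
  have fU: "f x \<in> ?U" if "x \<in> ?U" for x using Suc.prems(3) that by blast
  have e: "?e \<in> ?U" by (rule basis_enum_in_flag_sphere[OF m])

  obtain q where q: "q differentiable_on UNIV" "\<And>x. q (- x) = - q x" "q ` ?U \<subseteq> flag (Suc m)"
    and qf: "\<And>x. x \<in> ?U \<Longrightarrow> norm (f x - q x) < 1"
    by (rule odd_polynomial_approximation[OF compact_flag_sphere neg Suc.prems(2) Suc.prems(4) subspace_flag, of "Suc m" 1])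
      (use fU in auto)
  have qnz: "q x \<noteq> 0" if "x \<in> ?U" for x
    using qf[OF that] fU[OF that] by auto
  define g where "g = (\<lambda>x. q x /\<^sub>R norm (q x))"
  have gU: "g x \<in> ?U" if "x \<in> ?U" for x
    using q(3) qnz[OF that] that by (auto simp: g_def image_subset_iff intro!: subspace_scale subspace_flag)
  have g_odd: "g (- x) = - g x" for x
    by (simp add: g_def q(2))
  have qd: "q differentiable_on S" for S
    using q(1) differentiable_on_subset by blast
  have gd: "g differentiable_on ?U"
    unfolding g_def using qnz
    by (fastforce intro: derivative_intros qd differentiable_on_compose[OF qd])
  then have gc: "continuous_on ?U g" by (rule differentiable_imp_continuous_on)
  have "f x \<noteq> - g x" if "x \<in> ?U" for x
  proof
    assume "f x = - g x"
    then have "f x - q x = - ((1 + norm (q x)) *\<^sub>R g x)"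
      using qnz[OF that] by (simp add: g_def algebra_simps)
    then have "norm (f x - q x) = \<bar>1 + norm (q x)\<bar> * norm (g x)" by simp
    then have "norm (f x - q x) = 1 + norm (q x)" using gU[OF that] by simp
    then show False using qf[OF that] by simp
  qed
  then have deg_fg: "flag_degree (Suc m) f = flag_degree (Suc m) g"
    using Suc.prems gc gU by (intro flag_degree_homotopic) auto

  have "g ` ?W \<noteq> ?U"
    using m flag_mono[of m "Suc m"] differentiable_on_subset[OF gd WU]
    by (intro spheremap_lemma1) (auto simp: subspace_flag dim_flag)
  moreover have "g ` ?W \<subseteq> ?U" using gU WU by blast
  ultimately obtain c where c: "c \<in> ?U" "c \<notin> g ` ?W" by blast
  (* An orthogonal change of coordinates, so that the omitted point becomes the pole. *)
  define A where "A = swap_reflection c ?e"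
  have lin: "linear A" unfolding A_def by (rule linear_swap_reflection)
  have AU: "A x \<in> ?U" if "x \<in> ?U" for x
  proof -
    have "A x \<in> flag (Suc m)"
      unfolding A_def swap_reflection_def using that c e
      by (intro subspace_diff subspace_scale subspace_flag) auto
    then show ?thesis using that by (simp add: A_def norm_swap_reflection)
  qed
  have Ac: "A c = ?e" unfolding A_def using c e by (intro swap_reflection_swaps) simp
  have A_inj: "x = y" if "A x = A y" for x y
    using norm_swap_reflection[of c ?e "x - y"] that linear_diff[OF lin, of x y] by (simp add: A_def)
  have A_odd: "A (- x) = - A x" for x by (rule linear_neg[OF lin])
  have A_cont: "continuous_on S A" for S
    using lin by (rule linear_continuous_on[OF linear_conv_bounded_linear[THEN iffD1]])
  define h where "h = A \<circ> g"
  have hU: "h x \<in> ?U" if "x \<in> ?U" for x using AU gU that by (simp add: h_def)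
  have h_odd: "h (- x) = - h x" for x by (simp add: h_def g_odd A_odd)
  have hc: "continuous_on ?U h"
    unfolding h_def using gc A_cont by (intro continuous_on_compose)
  have deg_h: "flag_degree (Suc m) h = flag_degree (Suc m) A * flag_degree (Suc m) g"
    unfolding h_def using gc gU A_cont AU by (intro flag_degree_compose m) auto

  have h_ne: "h x \<noteq> ?e" if "x \<in> ?W" for x
    using c(2) that A_inj[of "g x" c] Ac by (auto simp: h_def)
  have h_lt: "\<bar>h x \<bullet> ?e\<bar> < 1" if "x \<in> ?W" for x
  proof -
    have n: "norm (h x) = 1" "norm ?e = 1" using hU[of x] e that WU by auto
    have "h x \<bullet> ?e \<noteq> 1" 
    proof
      assume "h x \<bullet> ?e = 1"
      then have "h x = ?e" using n norm_cauchy_schwarz_eq[of "h x" ?e] by simp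
      then show False using h_ne[OF that] by simp
    qed
    moreover have "h x \<bullet> ?e \<noteq> - 1"
    proof
      assume *: "h x \<bullet> ?e = - 1"
      have "norm (h (- x)) = 1" using n by (simp add: h_odd)
      then have "h (- x) = ?e" using * n norm_cauchy_schwarz_eq[of "h (- x)" ?e] by (simp add: h_odd)
      then show False using h_ne[OF uminus_flag_sphere[OF that]] by simp
    qed
    moreover have "\<bar>h x \<bullet> ?e\<bar> \<le> 1" using Cauchy_Schwarz_ineq2[of "h x" ?e] n by simp
    ultimately show ?thesis by linarith
  qed
  obtain C where C: "0 \<le> C" "C < 1" "\<And>x. x \<in> ?W \<Longrightarrow> \<bar>h x \<bullet> ?e\<bar> \<le> C"
  proof -
    have "basis_enum m \<in> ?W" using m by (intro basis_enum_in_flag_sphere) simp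
    then have "?W \<noteq> {}" by blast
    moreover have "continuous_on ?W (\<lambda>x. \<bar>h x \<bullet> ?e\<bar>)"
      by (intro continuous_intros continuous_on_subset[OF hc WU])
    ultimately obtain x0 where "x0 \<in> ?W" "\<And>x. x \<in> ?W \<Longrightarrow> \<bar>h x \<bullet> ?e\<bar> \<le> \<bar>h x0 \<bullet> ?e\<bar>"
      using continuous_attains_sup[OF compact_flag_sphere] by blast
    with h_lt show ?thesis by (intro that[of "\<bar>h x0 \<bullet> ?e\<bar>"]) auto
  qed
  (* Moves the last coordinate towards 0 by at most C. It becomes 0 on the image of the equator, while
     G vanishes nowhere on the sphere because C < 1. *)
  define G where "G = (\<lambda>y. y - max (- C) (min C (y \<bullet> ?e)) *\<^sub>R ?e)"
  have clamp: "norm (max (- C) (min C s) *\<^sub>R ?e) \<le> C" for s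
    using C(1) e by simp
  have Gnz: "G y \<noteq> 0" if "y \<in> ?U" for y
  proof
    assume "G y = 0"
    then have "norm y \<le> C" using clamp[of "y \<bullet> ?e"] by (simp add: G_def)
    then show False using that C by simp
  qed
  define k where "k = (\<lambda>x. G (h x) /\<^sub>R norm (G (h x)))"
  have kU: "k x \<in> ?U" if "x \<in> ?U" for x
  proof -
    have "G (h x) \<in> flag (Suc m)"
      unfolding G_def using hU[OF that] e by (intro subspace_diff subspace_scale subspace_flag) auto
    then show ?thesis
      using Gnz[OF hU[OF that]] by (auto simp: k_def intro!: subspace_scale subspace_flag)
  qed
  have G_odd: "G (- y) = - G y" for y
  proof -
    have "max (- C) (min C (- s)) = - max (- C) (min C s)" for s
      using C(1) by (auto simp: max_def min_def)
    then show ?thesis by (simp add: G_def)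
  qed
  have k_odd: "k (- x) = - k x" for x
    by (simp add: k_def h_odd G_odd)
  have Gc: "continuous_on ?U (\<lambda>x. G (h x))"
    unfolding G_def by (intro continuous_intros hc)
  have kc: "continuous_on ?U k"
    unfolding k_def using Gnz hU by (intro continuous_intros Gc) auto
  have "h x \<noteq> - k x" if "x \<in> ?U" for x
  proof
    assume "h x = - k x"
    then have "norm (G (h x)) *\<^sub>R h x = norm (G (h x)) *\<^sub>R - k x" by simp
    also have "\<dots> = - G (h x)"
      using Gnz[OF hU[OF that]] by (simp add: k_def)
    finally have "norm (G (h x)) *\<^sub>R h x = - G (h x)" .
    then have "(1 + norm (G (h x))) *\<^sub>R h x = max (- C) (min C (h x \<bullet> ?e)) *\<^sub>R ?e"
      by (simp add: G_def algebra_simps)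
    then have "norm ((1 + norm (G (h x))) *\<^sub>R h x) \<le> C" using clamp by simp
    then have "1 + norm (G (h x)) \<le> C" using hU[OF that] by simp
    then show False using C(2) norm_ge_zero[of "G (h x)"] by linarith
  qed
  then have deg_hk: "flag_degree (Suc m) h = flag_degree (Suc m) k"
    using hc hU kc kU by (intro flag_degree_homotopic m) auto
  have kW: "k x \<in> ?W" if "x \<in> ?W" for x
  proof -
    have "max (- C) (min C (h x \<bullet> ?e)) = h x \<bullet> ?e" using C(3)[OF that] by auto
    then have "k x \<bullet> ?e = 0"
      using inner_basis_enum[OF m m] by (simp add: k_def G_def inner_diff_left)
    then show ?thesis using kU[of x] that WU flag_Suc_inner_zero[OF _ m] by auto
  qed
  have "odd (flag_degree m k)"
    using m kW k_odd continuous_on_subset[OF kc WU] by (intro Suc.IH) auto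
  moreover have "even (flag_degree (Suc m) k - flag_degree m k)"
    using kU kW k_odd by (intro flag_degree_step m kc) auto
  ultimately have "odd (flag_degree (Suc m) k)" by simp
  then show ?case by (simp add: deg_fg deg_hk deg_h[symmetric]) (metis deg_h deg_hk even_mult_iff)
qed

text \<open>If no such \<open>u\<close> existed, the normalized differences \<open>f j u - f j (- u)\<close> would define an odd self-map
of the sphere whose last coordinate vanishes. It omits the pole, so its degree is \<open>0\<close>, which is
not odd.\<close>

theorem borsuk_ulam:
  fixes f :: "nat \<Rightarrow> 'a::euclidean_space \<Rightarrow> real"
  assumes f: "\<And>j. Suc j < DIM('a) \<Longrightarrow> continuous_on (sphere 0 1) (f j)"
  shows "\<exists>u. norm u = 1 \<and> (\<forall>j. Suc j < DIM('a) \<longrightarrow> f j u = f j (- u))"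
proof (rule ccontr)
  assume "\<not> ?thesis"
  then have no: "\<exists>j. Suc j < DIM('a) \<and> f j u \<noteq> f j (- u)" if "norm u = 1" for u
    using that by blast
  define M where "M = DIM('a) - 1"
  have M: "M < DIM('a)" by (simp add: M_def)
  have jM: "j < M \<longleftrightarrow> Suc j < DIM('a)" for j by (auto simp: M_def)
  have flag_UNIV: "flag M = (UNIV :: 'a set)" by (auto simp: flag_def coords_def M_def)
  define q where "q = (\<lambda>u::'a. \<Sum>j<M. (f j u - f j (- u)) *\<^sub>R (basis_enum j :: 'a))"
  have q_inner: "q u \<bullet> basis_enum i = (if i < M then f i u - f i (- u) else 0)" if "i < DIM('a)" for u i
  proof -
    have "q u \<bullet> basis_enum i = (\<Sum>j<M. (f j u - f j (- u)) * ((basis_enum j :: 'a) \<bullet> basis_enum i))"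
      by (simp add: q_def inner_sum_left)
    also have "\<dots> = (\<Sum>j<M. if j = i then f j u - f j (- u) else 0)"
      using that M by (intro sum.cong) (auto simp: inner_basis_enum)
    finally show ?thesis by simp
  qed
  have qnz: "q u \<noteq> 0" if u: "norm u = 1" for u
  proof
    assume "q u = 0"
    moreover obtain j where "j < M" "f j u \<noteq> f j (- u)" using no[OF u] jM by blast
    ultimately show False using q_inner[of j u] M by simp
  qed
  have "continuous_on (sphere 0 1) (\<lambda>u. f j (- u))" if "Suc j < DIM('a)" for j
    by (rule continuous_on_compose2[OF f[OF that]]) (auto intro!: continuous_intros)
  then have qc: "continuous_on (sphere 0 1) q"
    unfolding q_def using f by (intro continuous_intros) (auto simp: jM)
  define g where "g = (\<lambda>u. q u /\<^sub>R norm (q u))"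
  have "continuous_on (sphere 0 1) g"
    unfolding g_def using qnz by (intro continuous_intros qc) auto
  then have gc: "continuous_on (flag_sphere M) g" by (simp add: flag_UNIV)
  have gi: "g \<in> flag_sphere M \<rightarrow> flag_sphere M"
    using qnz by (auto simp: flag_UNIV g_def)
  have "q (- u) = - q u" for u
    by (simp add: q_def algebra_simps flip: sum_negf)
  then have "odd (flag_degree M g)"
    using gc gi M by (intro odd_flag_degree) (auto simp: g_def)
  moreover have "flag_degree M g = 0"
    unfolding flag_degree_def
  proof (rule Brouwer_degree2_nonsurjective[OF continuous_map_conj[OF M gc gi]])
    have e: "coords (basis_enum M :: 'a) \<in> topspace (nsphere M)"
      using basis_enum_in_flag_sphere[OF M] in_flag_sphere_iff[OF M] by blast
    have "coords (basis_enum M :: 'a) \<noteq> coords (g u)" for u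
    proof
      assume "coords (basis_enum M :: 'a) = coords (g u)"
      then have "basis_enum M = g u" by (metis of_coords_coords)
      then have "(basis_enum M :: 'a) \<bullet> basis_enum M = g u \<bullet> basis_enum M" by simp
      then show False using q_inner[OF M, of u] inner_basis_enum[OF M M] by (simp add: g_def)
    qed
    then have "coords (basis_enum M :: 'a) \<notin> (coords \<circ> g \<circ> of_coords) ` topspace (nsphere M)"
      by auto
    with e show "(coords \<circ> g \<circ> of_coords) ` topspace (nsphere M) \<noteq> topspace (nsphere M)"
      by blast
  qed
  ultimately show False by simp
qed

section \<open>The multifold Lusternik-Schnirelmann theorem and bodies of constant width\<close>

text \<open>For \<open>k = 1\<close>, \<open>p\<close> the identity and \<open>d = 2\<close> this is the Lusternik-Schnirelmann theorem: covering the sphere by sets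
without nearly antipodal points takes at least \<open>n + 1\<close> of them. The Borsuk-Ulam theorem is spent on
\<open>n - 1\<close> of the sets, which makes them avoid both \<open>u\<close> and \<open>- u\<close>; the others are counted.\<close>

theorem multifold_lusternik_schnirelmann:
  fixes p :: "'a::euclidean_space \<Rightarrow> 'b::metric_space"
  assumes "0 < k"
    and p: "continuous_on (sphere 0 1) p" "p ` sphere 0 1 \<subseteq> S"
    and d: "\<And>u. norm u = 1 \<Longrightarrow> d \<le> dist (p u) (p (- u))"
    and cover: "k_fold_cover k S m F"
    and F: "\<And>i. i < m \<Longrightarrow> bounded (F i) \<and> diameter (F i) < d"
  shows "2 * k + DIM('a) - 1 \<le> m"
proof -
  (* Indices from m onwards get the empty set, whose distance function is constant, so that m may
     be smaller than n - 1. *)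
  define K where "K = (\<lambda>j. if j < m then sphere 0 1 \<inter> p -` closure (F j) else {})"
  have K_closed: "closed (K j)" for j
    using continuous_closed_preimage[OF p(1)] by (simp add: K_def)
  have K_antipodal: "u \<notin> K j \<or> - u \<notin> K j" if "norm u = 1" for u j
  proof (rule ccontr)
    assume "\<not> ?thesis"
    then have "j < m" "p u \<in> closure (F j)" "p (- u) \<in> closure (F j)"
      by (auto simp: K_def split: if_splits)
    then have "dist (p u) (p (- u)) \<le> diameter (closure (F j))"
      using F by (intro diameter_bounded_bound) (auto simp: bounded_closure)
    also have "\<dots> < d" using F \<open>j < m\<close> by (simp add: diameter_closure)
    finally show False using d[OF that] by simp
  qed
  obtain u where u: "norm u = 1" "\<And>j. Suc j < DIM('a) \<Longrightarrow> infdist u (K j) = infdist (- u) (K j)"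
    using borsuk_ulam[of "\<lambda>j u. infdist u (K j)"] continuous_on_infdist[OF continuous_on_id] by blast
  have avoid: "u \<notin> K j \<and> - u \<notin> K j" if "Suc j < DIM('a)" for j
  proof (cases "K j = {}")
    case False
    then show ?thesis
      using in_closed_iff_infdist_zero[OF K_closed[of j] False] u(2)[OF that] K_antipodal[OF u(1), of j] by metis
  qed simp
  define I where "I = (\<lambda>v. {i \<in> {..<m}. p v \<in> F i})"
  have I_K: "v \<in> K i" if "i \<in> I v" "norm v = 1" for i v
    using that closure_subset[of "F i"] by (auto simp: I_def K_def)
  have card_I: "k \<le> card (I v)" if "norm v = 1" for v
  proof -
    have "p v \<in> S" using p(2) that by auto
    then show ?thesis using cover by (simp add: k_fold_cover_def I_def)
  qed
  have "I u \<inter> I (- u) = {}"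
    using K_antipodal[OF u(1)] I_K u(1) by fastforce
  then have "card (I u \<union> I (- u)) = card (I u) + card (I (- u))"
    by (intro card_Un_disjoint) (auto simp: I_def)
  moreover have "I u \<union> I (- u) \<subseteq> {DIM('a) - 1..<m}"
  proof
    fix i assume i: "i \<in> I u \<union> I (- u)"
    then have "\<not> Suc i < DIM('a)" using avoid[of i] I_K[of i] u(1) by auto
    then show "i \<in> {DIM('a) - 1..<m}" using i by (auto simp: I_def)
  qed
  then have "card (I u \<union> I (- u)) \<le> m - (DIM('a) - 1)"
    using card_mono[of "{DIM('a) - 1..<m}" "I u \<union> I (- u)"] by simp
  ultimately have "2 * k \<le> m - (DIM('a) - 1)"
    using card_I[of u] card_I[of "- u"] u(1) by simp
  then show ?thesis using \<open>0 < k\<close> DIM_positive[where 'a='a] by linarith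
qed

text \<open>Let \<open>x\<close> and \<open>y\<close> be support points in the directions \<open>u\<close> and \<open>- u\<close>. The width in direction \<open>u\<close> is
\<open>u \<bullet> (x - y) = w\<close>, while no two points of \<open>S\<close> are further apart than \<open>w\<close>. This is the equality case of the
Cauchy-Schwarz inequality, so \<open>x - y = w u\<close>. Thus \<open>y\<close> determines \<open>x\<close>, support points are unique, and the map
sending a direction to its support point has a closed graph in a compact set, which makes it continuous.\<close>

lemma constant_width_support_points:
  fixes S :: "'a::euclidean_space set"
  assumes "convex_body S" "constant_width S"
  obtains p :: "'a \<Rightarrow> 'a" where "continuous_on (sphere 0 1) p" "p ` sphere 0 1 \<subseteq> S"
    "\<And>u. norm u = 1 \<Longrightarrow> dist (p u) (p (- u)) = diameter S"
proof -
  have S: "compact S" "interior S \<noteq> {}"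
    using assms(1) by (auto simp: convex_body_def)
  then have "S \<noteq> {}" by auto
  define face where "face = (\<lambda>u. {x \<in> S. \<forall>z\<in>S. u \<bullet> z \<le> u \<bullet> x})"
  have "continuous_on S (\<lambda>z. u \<bullet> z)" for u
    by (intro continuous_intros)
  then have "\<exists>x. x \<in> face u" for u
    using continuous_attains_sup[OF S(1) \<open>S \<noteq> {}\<close>, of "\<lambda>z. u \<bullet> z"]
    by (auto simp: face_def)
  then obtain p where p: "\<And>u. p u \<in> face u" by metis
  then have pS: "p u \<in> S" for u by (auto simp: face_def)

  obtain w where w: "\<And>H1 H2. \<lbrakk>supporting_hyperplane S H1; supporting_hyperplane S H2; H1 \<noteq> H2;
      \<exists>v. H2 = (+) v ` H1\<rbrakk> \<Longrightarrow> setdist H1 H2 = w"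
    using assms(2) unfolding constant_width_def by metis
  have width: "u \<bullet> (x - y) = w \<and> 0 < w" if u: "norm u = 1" and x: "x \<in> face u" and y: "y \<in> face (- u)" for u x y
  proof -
    let ?c = "u \<bullet> x - u \<bullet> y"
    define H1 where "H1 = {z. u \<bullet> z = u \<bullet> x}"
    define H2 where "H2 = {z. u \<bullet> z = u \<bullet> y}"
    have u0: "u \<noteq> 0" and uu: "u \<bullet> u = 1" using u by (auto simp: norm_eq_1)
    have bd: "u \<bullet> y \<le> u \<bullet> z" "u \<bullet> z \<le> u \<bullet> x" if "z \<in> S" for z
      using x y that by (auto simp: face_def)
    have "x \<in> S" "y \<in> S" using x y by (auto simp: face_def)
    have "?c \<noteq> 0"
    proof
      assume "?c = 0"
      then have "S \<subseteq> {z. u \<bullet> z = u \<bullet> x}" using bd by force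
      then have "interior S \<subseteq> {}" using interior_mono interior_hyperplane[OF u0] by metis
      then show False using S(2) by simp
    qed
    then have c: "0 < ?c" using bd(1)[OF \<open>x \<in> S\<close>] by simp
    have "supporting_hyperplane S H1"
      unfolding supporting_hyperplane_def
      by (rule exI[of _ u], rule exI[of _ "u \<bullet> x"]) (use u0 bd \<open>x \<in> S\<close> in \<open>auto simp: H1_def\<close>)
    moreover have "supporting_hyperplane S H2"
      unfolding supporting_hyperplane_def
      by (rule exI[of _ "- u"], rule exI[of _ "- (u \<bullet> y)"]) (use u0 bd \<open>y \<in> S\<close> in \<open>auto simp: H2_def\<close>)
    moreover have "H1 \<noteq> H2"
    proof
      assume "H1 = H2"
      then have "x \<in> H2" by (auto simp: H1_def)
      then show False using c by (simp add: H2_def)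
    qed
    moreover have "H2 = (+) (y - x) ` H1"
    proof
      show "H2 \<subseteq> (+) (y - x) ` H1"
      proof
        fix z assume "z \<in> H2"
        then have "z - (y - x) \<in> H1" by (simp add: H1_def H2_def inner_diff_right)
        then show "z \<in> (+) (y - x) ` H1" by (rule image_eqI[rotated]) simp
      qed
    qed (auto simp: H1_def H2_def inner_add_right inner_diff_right)
    ultimately have "setdist H1 H2 = w" using w by blast
    moreover have "setdist H1 H2 = ?c"
    proof (rule antisym)
      have "x \<in> H1" "x - ?c *\<^sub>R u \<in> H2"
        using uu by (auto simp: H1_def H2_def inner_diff_right)
      then have "setdist H1 H2 \<le> dist x (x - ?c *\<^sub>R u)" by (rule setdist_le_dist)
      then show "setdist H1 H2 \<le> ?c" using c u by (simp add: dist_norm)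
      show "?c \<le> setdist H1 H2"
      proof (rule le_setdistI)
        fix a b assume "a \<in> H1" "b \<in> H2"
        then have "?c = u \<bullet> (a - b)" by (simp add: H1_def H2_def inner_diff_right)
        also have "\<dots> \<le> norm (a - b)" using norm_cauchy_schwarz[of u "a - b"] u by simp
        finally show "?c \<le> dist a b" by (simp add: dist_norm)
      qed (use \<open>x \<in> H1\<close> \<open>x - ?c *\<^sub>R u \<in> H2\<close> in blast)+
    qed
    ultimately show ?thesis using c by (simp add: inner_diff_right)
  qed
  obtain b where "b \<in> (Basis :: 'a set)" using nonempty_Basis by blast
  then have w0: "0 < w" using width[of b "p b" "p (- b)"] p by auto
  have dist_le: "dist a b \<le> w" if "a \<in> S" "b \<in> S" for a b
  proof (cases "a = b")
    case False
    define u where "u = (a - b) /\<^sub>R norm (a - b)"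
    have u: "norm u = 1" using False by (simp add: u_def)
    have "dist a b = u \<bullet> (a - b)"
      using False by (simp add: u_def dist_norm dot_square_norm power2_eq_square)
    also have "\<dots> \<le> u \<bullet> (p u - p (- u))"
      using p[of u] p[of "- u"] that by (auto simp: face_def inner_diff_right intro: diff_mono)
    also have "\<dots> = w" using width[OF u p p] by simp
    finally show ?thesis .
  qed (use w0 in simp)
  have opposite: "x = y + w *\<^sub>R u" if u: "norm u = 1" and x: "x \<in> face u" and y: "y \<in> face (- u)" for u x y
  proof -
    have "(norm (x - y))\<^sup>2 \<le> w\<^sup>2"
      using dist_le[of x y] x y by (intro power_mono) (auto simp: face_def dist_norm)
    moreover have "(norm (x - y - w *\<^sub>R u))\<^sup>2 = (norm (x - y))\<^sup>2 - 2 * w * (u \<bullet> (x - y)) + w\<^sup>2 * (u \<bullet> u)"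
      unfolding power2_norm_eq_inner
      by (simp add: inner_diff_left inner_diff_right inner_commute algebra_simps power2_eq_square)
    ultimately have "(norm (x - y - w *\<^sub>R u))\<^sup>2 \<le> 0"
      using width[OF that] u by (simp add: norm_eq_1 power2_eq_square)
    then have "x - y - w *\<^sub>R u = 0" by simp
    then show ?thesis by (simp add: algebra_simps)
  qed
  have face_unique: "x = p u" if "norm u = 1" "x \<in> face u" for u x
    using opposite[OF that p] opposite[OF that(1) p p] by simp
  have p_opposite: "dist (p u) (p (- u)) = w" if "norm u = 1" for u
    using opposite[OF that p p] that w0 by (simp add: dist_norm)
  have "diameter S = w"
  proof (rule antisym)
    show "diameter S \<le> w" using dist_le \<open>S \<noteq> {}\<close> by (intro diameter_le) (auto simp: dist_norm)
    obtain b where "b \<in> (Basis :: 'a set)" using nonempty_Basis by blast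
    then have "norm b = 1" by simp
    have "dist (p b) (p (- b)) \<le> diameter S"
      using pS compact_imp_bounded[OF S(1)] by (intro diameter_bounded_bound) auto
    then show "w \<le> diameter S" by (simp add: p_opposite[OF \<open>norm b = 1\<close>])
  qed
  moreover have "continuous_on (sphere 0 1) p"
  proof -
    have "(\<lambda>u. (u, p u)) ` sphere 0 1 =
        (sphere 0 1 \<times> S) \<inter> (\<Inter>z\<in>S. {q. fst q \<bullet> z \<le> fst q \<bullet> snd q})"
    proof (intro equalityI subsetI)
      fix q assume "q \<in> (\<lambda>u. (u, p u)) ` sphere 0 1"
      then show "q \<in> (sphere 0 1 \<times> S) \<inter> (\<Inter>z\<in>S. {q. fst q \<bullet> z \<le> fst q \<bullet> snd q})"
        using p by (auto simp: face_def)
    next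
      fix q assume q: "q \<in> (sphere 0 1 \<times> S) \<inter> (\<Inter>z\<in>S. {q. fst q \<bullet> z \<le> fst q \<bullet> snd q})"
      then have "snd q = p (fst q)"
        by (intro face_unique) (auto simp: face_def)
      then show "q \<in> (\<lambda>u. (u, p u)) ` sphere 0 1"
        using q by (intro image_eqI[of _ _ "fst q"]) (auto simp: prod_eq_iff)
    qed
    moreover have "closed {q::'a \<times> 'a. fst q \<bullet> z \<le> fst q \<bullet> snd q}" for z
      by (intro closed_Collect_le continuous_intros)
    then have "closed (\<Inter>z\<in>S. {q::'a \<times> 'a. fst q \<bullet> z \<le> fst q \<bullet> snd q})" by blast
    ultimately have "closedin (top_of_set (sphere 0 1 \<times> S)) ((\<lambda>u. (u, p u)) ` sphere 0 1)"
      by (simp only: closedin_closed_Int)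
    then show ?thesis
      using continuous_closed_graph_eq[OF S(1), of p "sphere 0 1"] pS by auto
  qed
  ultimately show ?thesis using that[of p] pS p_opposite by blast
qed

section \<open>Gale's lemma\<close>

text \<open>Dropping \<open>b\<close> elements from \<open>0, \<dots>, m - 1\<close> costs at most \<open>2 b\<close> elements of a subsequence of
alternating parity. The greedy choice does it: it takes the next element that satisfies \<open>C\<close> and
has the parity of the current length \<open>L\<close>. The bound survives an
element of the wrong parity, because \<open>m \<le> L + 2 b\<close> cannot be an equality when \<open>m\<close> and \<open>L\<close> have different
parities.\<close>

lemma alternating_selection:
  fixes C :: "nat \<Rightarrow> bool"
  shows "\<exists>L \<sigma>. (\<forall>j<L. \<sigma> j < m \<and> C (\<sigma> j) \<and> even (\<sigma> j + j)) \<and>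
    (\<forall>i j. i < j \<longrightarrow> j < L \<longrightarrow> \<sigma> i < (\<sigma> j :: nat)) \<and> m \<le> L + 2 * card {i\<in>{..<m}. \<not> C i}"
proof (induction m)
  case 0
  show ?case by (intro exI[of _ 0]) auto
next
  case (Suc m)
  then obtain L \<sigma> where L: "\<And>j. j < L \<Longrightarrow> \<sigma> j < m \<and> C (\<sigma> j) \<and> even (\<sigma> j + j)"
    "\<And>i j. i < j \<Longrightarrow> j < L \<Longrightarrow> \<sigma> i < \<sigma> j" "m \<le> L + 2 * card {i\<in>{..<m}. \<not> C i}"
    by blast
  have rest: "{i\<in>{..<Suc m}. \<not> C i} = (if C m then {i\<in>{..<m}. \<not> C i} else insert m {i\<in>{..<m}. \<not> C i})"
    by (auto simp: less_Suc_eq)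
  show ?case
  proof (cases "C m \<and> even (m + L)")
    case True
    define \<tau> where "\<tau> = \<sigma>(L := m)"
    have "\<forall>j<Suc L. \<tau> j < Suc m \<and> C (\<tau> j) \<and> even (\<tau> j + j)"
      using L(1) True by (auto simp: \<tau>_def less_Suc_eq)
    moreover have "\<forall>i j. i < j \<longrightarrow> j < Suc L \<longrightarrow> \<tau> i < \<tau> j"
      using L(1,2) by (auto simp: \<tau>_def less_Suc_eq)
    moreover have "Suc m \<le> Suc L + 2 * card {i\<in>{..<Suc m}. \<not> C i}"
      using L(3) True unfolding rest by simp
    ultimately show ?thesis by blast
  next
    case False
    have "Suc m \<le> L + 2 * card {i\<in>{..<Suc m}. \<not> C i}"
    proof (cases "C m")
      case True
      then have "odd (m + L)" using False by simp
      then have "m \<noteq> L + 2 * card {i\<in>{..<m}. \<not> C i}" by presburger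
      then show ?thesis using L(3) True unfolding rest by simp
    qed (use L(3) in \<open>unfold rest, simp\<close>)
    moreover have "\<forall>j<L. \<sigma> j < Suc m \<and> C (\<sigma> j) \<and> even (\<sigma> j + j)" using L(1) by (simp add: less_SucI)
    ultimately show ?thesis using L(2) by blast
  qed
qed

text \<open>The sum is the divided difference of \<open>P\<close> at \<open>n + 1\<close> nodes: the coefficient of degree \<open>n\<close> in the Lagrange
interpolation of \<open>P\<close>, which equals \<open>P\<close>.\<close>

lemma divided_difference_eq_0:
  fixes P :: "'a::field poly"
  assumes t: "inj_on t {..n}" and P: "degree P < n"
  shows "(\<Sum>j\<le>n. poly P (t j) / (\<Prod>l\<in>{..n}-{j}. t j - t l)) = 0"
proof -
  define w where "w = (\<lambda>j. \<Prod>l\<in>{..n}-{j}. [:- t l, 1:])"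
  define c where "c = (\<lambda>j. poly P (t j) / (\<Prod>l\<in>{..n}-{j}. t j - t l))"
  have dw: "degree (w j) = n" if "j \<le> n" for j
    using that by (simp add: w_def degree_prod_eq_sum_degree)
  have lw: "poly.coeff (w j) n = 1" if "j \<le> n" for j
    using lead_coeff_prod[of "\<lambda>l. [:- t l, 1:]" "{..n}-{j}"] dw[OF that] by (simp add: w_def)
  define R where "R = (\<Sum>j\<le>n. Polynomial.smult (c j) (w j))"
  have "poly R (t i) = poly P (t i)" if "i \<le> n" for i
  proof -
    have pw: "poly (w j) (t i) = (if j = i then (\<Prod>l\<in>{..n}-{i}. t i - t l) else 0)" if "j \<le> n" for j
      using that \<open>i \<le> n\<close> by (auto simp: w_def poly_prod intro!: prod_zero)
    have "poly R (t i) = (\<Sum>j\<le>n. if j = i then c i * (\<Prod>l\<in>{..n}-{i}. t i - t l) else 0)"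
      unfolding R_def poly_sum by (intro sum.cong) (auto simp: pw)
    also have "\<dots> = c i * (\<Prod>l\<in>{..n}-{i}. t i - t l)" using \<open>i \<le> n\<close> by simp
    also have "(\<Prod>l\<in>{..n}-{i}. t i - t l) \<noteq> 0"
      using t \<open>i \<le> n\<close> by (auto simp: inj_on_def)
    then have "c i * (\<Prod>l\<in>{..n}-{i}. t i - t l) = poly P (t i)" by (simp add: c_def)
    finally show ?thesis .
  qed
  moreover have "degree R \<le> n"
    unfolding R_def using dw by (intro degree_sum_le) (auto intro: order_trans[OF degree_smult_le])
  ultimately have "P = R"
    using P t by (intro poly_eqI_degree[of "t ` {..n}"]) (auto simp: card_image)
  then have "poly.coeff R n = 0" using P by (simp add: coeff_eq_0)
  then show ?thesis
    by (simp add: R_def coeff_sum lw c_def)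
qed

lemma sign_node_product:
  fixes t :: "nat \<Rightarrow> real"
  assumes t: "\<And>i j. i < j \<Longrightarrow> j \<le> n \<Longrightarrow> t i < t j" and "j \<le> n"
  shows "0 < (-1) ^ (n - j) * (\<Prod>l\<in>{..n}-{j}. t j - t l)"
proof -
  have split: "{..n} - {j} = {..<j} \<union> {j<..n}" using \<open>j \<le> n\<close> by auto
  have "(\<Prod>l\<in>{..n}-{j}. t j - t l) = (\<Prod>l<j. t j - t l) * (\<Prod>l\<in>{j<..n}. t j - t l)"
    unfolding split by (rule prod.union_disjoint) auto
  also have "(\<Prod>l\<in>{j<..n}. t j - t l) = (-1) ^ (n - j) * (\<Prod>l\<in>{j<..n}. t l - t j)"
    using prod_uminus[of "\<lambda>l. t l - t j" "{j<..n}"] by simp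
  finally have "(-1) ^ (n - j) * (\<Prod>l\<in>{..n}-{j}. t j - t l) =
      ((-1) ^ (n - j) * (-1) ^ (n - j)) * ((\<Prod>l<j. t j - t l) * (\<Prod>l\<in>{j<..n}. t l - t j))"
    by (simp only: mult_ac)
  moreover have "0 < (\<Prod>l<j. t j - t l) * (\<Prod>l\<in>{j<..n}. t l - t j)"
    using t \<open>j \<le> n\<close> by (intro mult_pos_pos prod_pos) auto
  ultimately show ?thesis by (simp flip: power_mult_distrib)
qed

text \<open>The denominators of the divided difference alternate in sign, so here all its terms have the same weak
sign. As they add up to \<open>0\<close> they all vanish, and \<open>P\<close> has \<open>n + 1\<close> roots. Using divided differences
instead of the intermediate value theorem avoids counting multiplicities of roots at the nodes.\<close>

lemma weakly_alternating_poly_eq_0: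
  fixes P :: "real poly"
  assumes t: "\<And>i j. i < j \<Longrightarrow> j \<le> n \<Longrightarrow> t i < t j" and P: "degree P < n"
    and alt: "\<And>j. j \<le> n \<Longrightarrow> (-1) ^ j * poly P (t j) \<le> 0"
  shows "P = 0"
proof -
  define D where "D = (\<lambda>j. \<Prod>l\<in>{..n}-{j}. t j - t l)"
  have inj: "inj_on t {..n}"
    using t by (intro linorder_inj_onI) (auto simp: less_imp_neq)
  have D: "0 < (-1) ^ (n - j) * D j" if "j \<le> n" for j
    unfolding D_def using t that by (rule sign_node_product)
  have eq: "(-1) ^ n * (poly P (t j) / D j) = ((-1) ^ j * poly P (t j)) / ((-1) ^ (n - j) * D j)"
    if "j \<le> n" for j
  proof -
    have "((-1) ^ n :: real) * (-1) ^ (n - j) = (-1) ^ j"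
      using that by (auto simp: minus_one_power_iff)
    moreover have "(poly P (t j) / D j) = (-1) ^ (n - j) * poly P (t j) / ((-1) ^ (n - j) * D j)" by simp
    ultimately show ?thesis by (metis (no_types, opaque_lifting) mult.assoc times_divide_eq_right)
  qed
  have le: "(-1) ^ n * (poly P (t j) / D j) \<le> 0" if "j \<le> n" for j
    unfolding eq[OF that] using alt[OF that] D[OF that] by (simp add: divide_nonpos_pos)
  have "(\<Sum>j\<le>n. (-1) ^ n * (poly P (t j) / D j)) = 0"
    unfolding sum_distrib_left[symmetric] D_def divided_difference_eq_0[OF inj P] by simp
  then have "\<forall>j\<in>{..n}. (-1) ^ n * (poly P (t j) / D j) = 0"
    using le sum_nonneg_eq_0_iff[of "{..n}" "\<lambda>j. - ((-1) ^ n * (poly P (t j) / D j))"]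
    by (simp add: sum_negf)
  then have "poly P (t j) = 0" if "j \<le> n" for j
    using that D[OF that] by fastforce
  then show ?thesis
    using P inj by (intro poly_eqI_degree[of "t ` {..n}"]) (auto simp: card_image)
qed

text \<open>Gale's lemma. The vectors are \<open>(-1)\<^sup>i (1, i, i\<^sup>2, \<dots>)\<close>, so the inner product with \<open>x\<close> is \<open>(-1)\<^sup>i P(i)\<close>,
where \<open>P\<close> is the polynomial of degree less than \<open>n\<close> with coefficients \<open>x\<close>. If fewer than \<open>k\<close> of these values were
positive, discarding the positive ones would leave \<open>n + 1\<close> nodes of alternating parity, at which \<open>P\<close>
alternates weakly; then \<open>P = 0\<close>.\<close>

lemma gale_open_hemispheres:
  assumes "0 < k"
  obtains v :: "nat \<Rightarrow> 'a::euclidean_space"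
    where "\<And>x. x \<noteq> 0 \<Longrightarrow> k \<le> card {i \<in> {..<2 * k + DIM('a) - 1}. 0 < v i \<bullet> x}"
proof -
  let ?N = "DIM('a)" and ?m = "2 * k + DIM('a) - 1"
  define v where "v = (\<lambda>i. (-1) ^ i *\<^sub>R (\<Sum>j<?N. real i ^ j *\<^sub>R (basis_enum j :: 'a)))"
  have "k \<le> card {i \<in> {..<?m}. 0 < v i \<bullet> x}" if "x \<noteq> 0" for x
  proof (rule ccontr)
    assume few: "\<not> ?thesis"
    define P where "P = (\<Sum>j<?N. Polynomial.monom (x \<bullet> basis_enum j) j)"
    have vP: "v i \<bullet> x = (-1) ^ i * poly P (real i)" for i
    proof -
      have "(\<Sum>j<?N. real i ^ j *\<^sub>R (basis_enum j :: 'a)) \<bullet> x = poly P (real i)"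
        by (simp add: P_def inner_sum_left poly_sum poly_monom inner_commute[of x] mult.commute)
      then show ?thesis by (simp add: v_def)
    qed
    have coeffP: "poly.coeff P j = x \<bullet> basis_enum j" if "j < ?N" for j
      using that by (simp add: P_def coeff_sum)
    have "degree P < ?N"
      unfolding P_def by (rule degree_sum_less) (auto intro: le_less_trans[OF degree_monom_le])
    obtain L \<sigma> where L: "\<And>j. j < L \<Longrightarrow> \<not> 0 < v (\<sigma> j) \<bullet> x \<and> even (\<sigma> j + j)"
      "\<And>i j. i < j \<Longrightarrow> j < L \<Longrightarrow> \<sigma> i < \<sigma> j" "?m \<le> L + 2 * card {i\<in>{..<?m}. 0 < v i \<bullet> x}"
      using alternating_selection[where C="\<lambda>i. \<not> 0 < v i \<bullet> x" and m="?m"] by auto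
    have "?N < L" using L(3) few \<open>0 < k\<close> by linarith
    have "P = 0"
    proof (rule weakly_alternating_poly_eq_0[where n="?N" and t="\<lambda>j. real (\<sigma> j)"])
      show "real (\<sigma> i) < real (\<sigma> j)" if "i < j" "j \<le> ?N" for i j
        using L(2) that \<open>?N < L\<close> by simp
      show "(-1) ^ j * poly P (real (\<sigma> j)) \<le> 0" if "j \<le> ?N" for j
      proof -
        have "(-1 :: real) ^ j = (-1) ^ \<sigma> j"
          using L(1)[of j] that \<open>?N < L\<close> by (auto simp: minus_one_power_iff)
        then show ?thesis using L(1)[of j] that \<open>?N < L\<close> vP[of "\<sigma> j"] by simp
      qed
    qed fact
    then have "coords x i = 0" for i
      using coeffP[of i] by (auto simp: coords_def)
    then have "x = 0" using norm_coords[of x] by simp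
    with \<open>x \<noteq> 0\<close> show False by simp
  qed
  then show ?thesis by (rule that)
qed

text \<open>Uniformity in \<open>u\<close> by compactness: at a limit of directions violating the claim with \<open>\<epsilon>\<close> tending to \<open>0\<close>,
at least \<open>k\<close> inner products are positive, and these stay bounded away from \<open>0\<close> nearby.\<close>

lemma gale_closed_caps:
  assumes "0 < k"
  obtains v :: "nat \<Rightarrow> 'a::euclidean_space" and \<epsilon> where "0 < \<epsilon>"
    "\<And>u. norm u = 1 \<Longrightarrow> k \<le> card {i \<in> {..<2 * k + DIM('a) - 1}. \<epsilon> \<le> v i \<bullet> u}"
proof -
  let ?m = "2 * k + DIM('a) - 1"
  obtain v :: "nat \<Rightarrow> 'a" where v: "\<And>x. x \<noteq> 0 \<Longrightarrow> k \<le> card {i \<in> {..<?m}. 0 < v i \<bullet> x}"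
    using gale_open_hemispheres[OF assms, where 'a='a] by blast
  have "\<exists>\<epsilon>>0. \<forall>u. norm u = 1 \<longrightarrow> k \<le> card {i \<in> {..<?m}. \<epsilon> \<le> v i \<bullet> u}"
  proof (rule ccontr)
    assume "\<not> ?thesis"
    then have "\<exists>u. norm u = 1 \<and> card {i \<in> {..<?m}. inverse (real (Suc n)) \<le> v i \<bullet> u} < k" for n
      by (metis inverse_positive_iff_positive not_le of_nat_0_less_iff zero_less_Suc)
    then obtain u where u: "\<And>n. norm (u n) = 1"
        "\<And>n. card {i \<in> {..<?m}. inverse (real (Suc n)) \<le> v i \<bullet> u n} < k"
      by metis
    have "\<forall>n. u n \<in> sphere 0 1" using u(1) by simp
    then obtain l r where l: "l \<in> sphere 0 1" "strict_mono (r :: nat \<Rightarrow> nat)" "(u \<circ> r) \<longlonglongrightarrow> l"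
      using compact_sphere[of "0::'a" 1] unfolding compact_def by metis
    define J where "J = {i \<in> {..<?m}. 0 < v i \<bullet> l}"
    have "\<forall>\<^sub>F n in sequentially. 0 < v i \<bullet> u (r n) - inverse (real (Suc (r n)))" if "i \<in> J" for i
    proof -
      have "(\<lambda>n. inverse (real (Suc (r n)))) \<longlonglongrightarrow> 0"
        using LIMSEQ_subseq_LIMSEQ[OF LIMSEQ_inverse_real_of_nat l(2)] by (simp add: o_def)
      then have "(\<lambda>n. v i \<bullet> u (r n) - inverse (real (Suc (r n)))) \<longlonglongrightarrow> v i \<bullet> l - 0"
        using l(3) by (intro tendsto_intros) (simp_all add: o_def)
      then show ?thesis
        by (rule order_tendstoD(1)) (use that in \<open>simp add: J_def\<close>)
    qed
    then have "\<forall>\<^sub>F n in sequentially. \<forall>i\<in>J. 0 < v i \<bullet> u (r n) - inverse (real (Suc (r n)))"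
      by (intro eventually_ball_finite) (auto simp: J_def)
    then obtain n where n: "\<forall>i\<in>J. 0 < v i \<bullet> u (r n) - inverse (real (Suc (r n)))"
      using eventually_happens'[OF sequentially_bot] by blast
    have "J \<subseteq> {i \<in> {..<?m}. inverse (real (Suc (r n))) \<le> v i \<bullet> u (r n)}"
      using n by (auto simp: J_def)
    then have "card J \<le> card {i \<in> {..<?m}. inverse (real (Suc (r n))) \<le> v i \<bullet> u (r n)}"
      by (intro card_mono) auto
    also have "\<dots> < k" by (rule u(2))
    finally have "card J < k" .
    moreover have "l \<noteq> 0" using l(1) by auto
    ultimately show False using v[of l] by (simp add: J_def)
  qed
  then show ?thesis using that by blast
qed

section \<open>Covering sets with unique diametral partners\<close>

lemma compact_diametral_points:
  fixes S :: "'a::metric_space set"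
  assumes "compact S"
  shows "compact {x \<in> S. \<exists>y\<in>S. dist x y = d}"
proof -
  have "closed {q :: 'a \<times> 'a. dist (fst q) (snd q) = d}"
    by (intro closed_Collect_eq continuous_intros)
  then have "compact (S \<times> S \<inter> {q. dist (fst q) (snd q) = d})"
    using assms by (intro compact_Int_closed compact_Times)
  then have "compact (fst ` (S \<times> S \<inter> {q. dist (fst q) (snd q) = d}))"
    by (intro compact_continuous_image continuous_intros)
  moreover have "fst ` (S \<times> S \<inter> {q. dist (fst q) (snd q) = d}) = {x \<in> S. \<exists>y\<in>S. dist x y = d}"
    by force
  ultimately show ?thesis by simp
qed

text \<open>Each of the finitely many compact sets attains its diameter, which leaves room for thickening all of
them by a common \<open>\<delta>\<close>.\<close>

lemma common_margin:
  fixes G :: "nat \<Rightarrow> 'a::metric_space set"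
  assumes "\<And>i. i < m \<Longrightarrow> compact (G i)" and "\<And>i x y. i < m \<Longrightarrow> x \<in> G i \<Longrightarrow> y \<in> G i \<Longrightarrow> dist x y < d"
  shows "\<exists>\<delta>>0. \<forall>i<m. \<forall>x\<in>G i. \<forall>y\<in>G i. dist x y + 2 * \<delta> < d"
  using assms
proof (induction m)
  case 0
  show ?case by (intro exI[of _ 1]) simp
next
  case (Suc m)
  then obtain \<delta> where \<delta>: "0 < \<delta>" "\<And>i x y. i < m \<Longrightarrow> x \<in> G i \<Longrightarrow> y \<in> G i \<Longrightarrow> dist x y + 2 * \<delta> < d"
    by (metis less_SucI)
  obtain \<eta> where \<eta>: "0 < \<eta>" "\<And>x y. x \<in> G m \<Longrightarrow> y \<in> G m \<Longrightarrow> dist x y + 2 * \<eta> < d"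
  proof (cases "G m = {}")
    case True
    then show ?thesis using that[of 1] by simp
  next
    case False
    have G: "compact (G m)" using Suc.prems(1) by simp
    obtain a b where ab: "a \<in> G m" "b \<in> G m" "dist a b = diameter (G m)"
      using diameter_compact_attained[OF G False] by blast
    have le: "dist x y \<le> diameter (G m)" if "x \<in> G m" "y \<in> G m" for x y
      using diameter_bounded_bound[OF compact_imp_bounded[OF G] that] .
    have lt: "diameter (G m) < d" using ab Suc.prems(2)[of m a b] by simp
    show ?thesis
    proof (rule that[of "(d - diameter (G m)) / 3"])
      fix x y assume "x \<in> G m" "y \<in> G m"
      then show "dist x y + 2 * ((d - diameter (G m)) / 3) < d"
        using le[of x y] lt by (simp add: field_simps)
    qed (use lt in simp)
  qed
  have "dist x y + 2 * min \<delta> \<eta> < d" if "i < Suc m" "x \<in> G i" "y \<in> G i" for i x y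
  proof (cases "i = m")
    case True
    then show ?thesis using \<eta>(2)[of x y] that by (simp add: min_def)
  next
    case False
    then show ?thesis using \<delta>(2)[of i x y] that by (simp add: min_def)
  qed
  then show ?case using \<delta>(1) \<eta>(1) by (intro exI[of _ "min \<delta> \<eta>"]) auto
qed

text \<open>Call the point at distance \<open>diameter S\<close> from \<open>x\<close> its partner. Two points of one member of the cover at that
distance would be partners of each other and hence not far from the set \<open>E\<close> of points with
a partner, so both would lie near the same \<open>G i\<close>, where distances are bounded away from
\<open>diameter S\<close>.\<close>

theorem unique_partner_cover:
  fixes S :: "'a::euclidean_space set"
  assumes S: "compact S" and d: "diameter S > 0" and "0 < k"
    and unique: "\<And>x y z. \<lbrakk>x \<in> S; y \<in> S; z \<in> S; dist x y = diameter S; dist x z = diameter S\<rbrakk> \<Longrightarrow> y = z"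
  shows "\<exists>F. k_fold_cover k S (2 * k + DIM('a) - 1) F \<and>
    (\<forall>i<2 * k + DIM('a) - 1. bounded (F i) \<and> diameter (F i) < diameter S)"
proof -
  let ?m = "2 * k + DIM('a) - 1" and ?d = "diameter S"
  define E where "E = {x \<in> S. \<exists>y\<in>S. dist x y = ?d}"
  have E: "compact E" unfolding E_def by (rule compact_diametral_points[OF S])
  have "\<exists>y. y \<in> S \<and> dist x y = ?d" if "x \<in> E" for x using that by (auto simp: E_def)
  then obtain r where r: "\<And>x. x \<in> E \<Longrightarrow> r x \<in> S \<and> dist x (r x) = ?d" by metis
  have ES: "x \<in> S" if "x \<in> E" for x using that by (simp add: E_def)
  have rE: "r x \<in> E" if "x \<in> E" for x
    using r[OF that] ES[OF that] by (auto simp: E_def dist_commute)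
  have r_unique: "r x = y" if "x \<in> E" "y \<in> S" "dist x y = ?d" for x y
    using unique[of x "r x" y] r[of x] ES that by blast
  have rr: "r (r x) = x" if "x \<in> E" for x
    using r_unique[OF rE[OF that] ES[OF that]] r[OF that] by (simp add: dist_commute)
  have r_cont: "continuous_on E r"
  proof -
    have "(\<lambda>x. (x, r x)) ` E = E \<times> E \<inter> {q. dist (fst q) (snd q) = ?d}"
    proof (intro equalityI subsetI)
      fix q assume "q \<in> (\<lambda>x. (x, r x)) ` E"
      then show "q \<in> E \<times> E \<inter> {q. dist (fst q) (snd q) = ?d}" using r rE by auto
    next
      fix q assume q: "q \<in> E \<times> E \<inter> {q. dist (fst q) (snd q) = ?d}"
      then have "r (fst q) = snd q" using ES by (intro r_unique) auto
      then show "q \<in> (\<lambda>x. (x, r x)) ` E"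
        using q by (intro image_eqI[of _ _ "fst q"]) (auto simp: prod_eq_iff)
    qed
    moreover have "closed {q :: 'a \<times> 'a. dist (fst q) (snd q) = ?d}"
      by (intro closed_Collect_eq continuous_intros)
    ultimately have "closedin (top_of_set (E \<times> E)) ((\<lambda>x. (x, r x)) ` E)"
      by (simp only: closedin_closed_Int)
    then show ?thesis using continuous_closed_graph_eq[OF E, of r E] rE by auto
  qed
  define u where "u = (\<lambda>x. (x - r x) /\<^sub>R ?d)"
  have u_norm: "norm (u x) = 1" if "x \<in> E" for x
    using r[OF that] d by (simp add: u_def dist_norm)
  have u_r: "u (r x) = - u x" if "x \<in> E" for x
    unfolding u_def rr[OF that] by (simp flip: scaleR_minus_right)
  have u_cont: "continuous_on E u"
    unfolding u_def by (intro continuous_intros r_cont)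

  obtain v :: "nat \<Rightarrow> 'a" and \<epsilon> where "0 < \<epsilon>"
    and v: "\<And>u. norm u = 1 \<Longrightarrow> k \<le> card {i \<in> {..<?m}. \<epsilon> \<le> v i \<bullet> u}"
    using gale_closed_caps[OF \<open>0 < k\<close>, where 'a='a] by blast
  (* The preimages of the caps. Partners have opposite directions, so they never share a cap. *)
  define G where "G = (\<lambda>i. E \<inter> (\<lambda>x. v i \<bullet> u x) -` {\<epsilon>..})"
  have G_compact: "compact (G i)" for i
  proof -
    have "closed (G i)"
      unfolding G_def using compact_imp_closed[OF E]
      by (intro continuous_closed_preimage continuous_intros u_cont) auto
    then show ?thesis using compact_Int_closed[OF E, of "G i"] by (simp add: G_def)
  qed
  have G_dist: "dist x y < ?d" if "x \<in> G i" "y \<in> G i" for i x y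
  proof -
    have xy: "x \<in> E" "y \<in> E" using that by (auto simp: G_def)
    have "dist x y \<noteq> ?d"
    proof
      assume "dist x y = ?d"
      then have "r x = y" using xy ES by (intro r_unique) auto
      then have "u y = - u x" using u_r[OF xy(1)] by simp
      then show False using that \<open>0 < \<epsilon>\<close> by (simp add: G_def)
    qed
    moreover have "dist x y \<le> ?d"
      using xy ES by (intro diameter_bounded_bound compact_imp_bounded S) auto
    ultimately show ?thesis by simp
  qed
  obtain \<delta> where "0 < \<delta>" and \<delta>: "\<And>i x y. i < ?m \<Longrightarrow> x \<in> G i \<Longrightarrow> y \<in> G i \<Longrightarrow> dist x y + 2 * \<delta> < ?d"
    using common_margin[of ?m G ?d] G_compact G_dist by blast
  (* A single distance \<delta> for all members: a point that is not far from E is close to one z in E,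
     and belongs to the thickening of every G i that contains z. *)
  define far where "far = S \<inter> (\<Inter>z\<in>E. {x. \<delta> \<le> dist x z})"
  define near where "near = (\<lambda>i. S \<inter> {z + y | z y. z \<in> G i \<and> y \<in> cball 0 \<delta>})"
  define F where "F = (\<lambda>i. far \<union> near i)"
  have near_iff: "x \<in> near i \<longleftrightarrow> x \<in> S \<and> (\<exists>z\<in>G i. dist x z \<le> \<delta>)" for x i
  proof
    assume "x \<in> S \<and> (\<exists>z\<in>G i. dist x z \<le> \<delta>)"
    then obtain z where z: "x \<in> S" "z \<in> G i" "dist x z \<le> \<delta>" by blast
    then have "x = z + (x - z)" "x - z \<in> cball 0 \<delta>" by (auto simp: dist_norm norm_minus_commute)
    then show "x \<in> near i" using z unfolding near_def by blast
  next
    assume "x \<in> near i"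
    then obtain z y where zy: "x \<in> S" "z \<in> G i" "x = z + y" "norm y \<le> \<delta>"
      by (auto simp: near_def)
    then have "dist x z \<le> \<delta>" by (simp add: dist_norm)
    then show "x \<in> S \<and> (\<exists>z\<in>G i. dist x z \<le> \<delta>)" using zy by blast
  qed
  have F_compact: "compact (F i)" for i
  proof -
    have "closed {x. \<delta> \<le> dist x z}" for z :: 'a
      by (intro closed_Collect_le continuous_intros)
    then have "closed (\<Inter>z\<in>E. {x. \<delta> \<le> dist x z})" by blast
    then have "compact far" unfolding far_def using S by (intro compact_Int_closed)
    moreover have "compact (near i)"
      unfolding near_def using S G_compact by (intro compact_Int compact_sums) auto
    ultimately show ?thesis unfolding F_def by (rule compact_Un)
  qed
  have FS: "F i \<subseteq> S" for i by (auto simp: F_def far_def near_def)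
  have "diameter (F i) < ?d" if "i < ?m" for i
  proof (cases "F i = {}")
    case False
    then obtain x y where xy: "x \<in> F i" "y \<in> F i" "dist x y = diameter (F i)"
      using diameter_compact_attained[OF F_compact] by blast
    have "dist x y \<le> ?d"
      using xy FS by (intro diameter_bounded_bound compact_imp_bounded S) auto
    moreover have "dist x y \<noteq> ?d"
    proof
      assume eq: "dist x y = ?d"
      have "x \<in> S" "y \<in> S" using xy FS by auto
      then have "x \<in> E" "y \<in> E" using eq by (auto simp: E_def dist_commute)
      then have "x \<notin> far" "y \<notin> far" using \<open>0 < \<delta>\<close> by (force simp: far_def)+
      then obtain x' y' where "x' \<in> G i" "y' \<in> G i" "dist x x' \<le> \<delta>" "dist y y' \<le> \<delta>"
        using xy near_iff by (auto simp: F_def)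
      then have "dist x y < ?d"
        using \<delta>[OF that, of x' y'] dist_triangle[of x y x'] dist_triangle[of x' y y'] dist_commute[of y y'] by simp
      then show False using eq by simp
    qed
    ultimately show ?thesis using xy by simp
  qed (use d in \<open>simp add: diameter_def\<close>)
  moreover have "k_fold_cover k S ?m F"
    unfolding k_fold_cover_def
  proof
    fix x assume "x \<in> S"
    show "k \<le> card {i \<in> {..<?m}. x \<in> F i}"
    proof (cases "x \<in> far")
      case True
      then have "{i \<in> {..<?m}. x \<in> F i} = {..<?m}" by (auto simp: F_def)
      then show ?thesis using \<open>0 < k\<close> DIM_positive[where 'a='a] by simp
    next
      case False
      then obtain z where z: "z \<in> E" "dist x z \<le> \<delta>" using \<open>x \<in> S\<close> by (force simp: far_def)
      have "{i \<in> {..<?m}. \<epsilon> \<le> v i \<bullet> u z} \<subseteq> {i \<in> {..<?m}. x \<in> F i}"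
        using z \<open>x \<in> S\<close> near_iff by (auto simp: F_def G_def)
      then have "card {i \<in> {..<?m}. \<epsilon> \<le> v i \<bullet> u z} \<le> card {i \<in> {..<?m}. x \<in> F i}"
        by (intro card_mono) auto
      then show ?thesis using v[OF u_norm[OF z(1)]] by simp
    qed
  qed
  ultimately show ?thesis using F_compact compact_imp_bounded by blast
qed

section \<open>Smooth bodies and centrally symmetric sets\<close>

text \<open>The cone from \<open>a\<close> over a differentiable image of a set of codimension two has one dimension more, and so
is still negligible. The extra parameter \<open>s\<close> is encoded as the coordinate in a direction \<open>e\<close> orthogonal
to \<open>T\<close>, so that the cone is the image of a negligible set under a map of the space to itself.\<close>

lemma negligible_cone_over_chart:
  fixes \<psi> :: "'a::euclidean_space \<Rightarrow> 'a"
  assumes V: "open V" "C1_on V \<psi>" and T: "subspace T" "dim T + 2 \<le> DIM('a)"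
  shows "negligible {a + s *\<^sub>R (\<psi> z - a) | s z. z \<in> T \<inter> V}"
proof -
  have "dim T < DIM('a)" using T(2) by simp
  then obtain e0 where e0: "e0 \<noteq> 0" "\<And>y. y \<in> span T \<Longrightarrow> orthogonal e0 y"
    using orthogonal_to_subspace_exists by metis
  define e where "e = e0 /\<^sub>R norm e0"
  have "norm e = 1" using e0(1) by (simp add: e_def)
  then have ee: "e \<bullet> e = 1" by (simp add: norm_eq_1)
  have eT: "z \<bullet> e = 0" if "z \<in> T" for z
    using e0(2)[of z] that by (simp add: e_def orthogonal_def span_base inner_commute)
  define Q where "Q = {z + s *\<^sub>R e | s z. z \<in> T \<inter> V}"
  have pr: "(z + s *\<^sub>R e) \<bullet> e = s" "(z + s *\<^sub>R e) - ((z + s *\<^sub>R e) \<bullet> e) *\<^sub>R e = z" if "z \<in> T" for z s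
    using eT[OF that] ee by (auto simp: inner_add_left)
  have "Q \<subseteq> span (insert e T)"
    unfolding Q_def by (blast intro: span_add span_scale span_base)
  then have "dim Q \<le> dim (insert e T)" by (metis dim_span dim_subset)
  also have "\<dots> \<le> dim T + 1" by (simp add: dim_insert)
  finally have "negligible Q" using T(2) by (intro negligible_lowdim) simp
  define g where "g = (\<lambda>q. a + (q \<bullet> e) *\<^sub>R (\<psi> (q - (q \<bullet> e) *\<^sub>R e) - a))"
  have "g differentiable (at q)" if q: "q \<in> Q" for q
  proof -
    obtain z s where zs: "q = z + s *\<^sub>R e" "z \<in> T" "z \<in> V" using q unfolding Q_def by blast
    then have "q - (q \<bullet> e) *\<^sub>R e \<in> V" by (simp only: pr(2)[OF zs(2)])
    then have \<psi>: "\<psi> differentiable (at (q - (q \<bullet> e) *\<^sub>R e))"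
      using V(2) by (auto simp: C1_on_def differentiable_def)
    have inner: "(\<lambda>q. q \<bullet> e) differentiable (at q)"
      by (intro bounded_linear_imp_differentiable bounded_linear_inner_left)
    then have "(\<lambda>q. q - (q \<bullet> e) *\<^sub>R e) differentiable (at q)"
      by (intro derivative_intros) auto
    then have "(\<psi> \<circ> (\<lambda>q. q - (q \<bullet> e) *\<^sub>R e)) differentiable (at q)"
      using \<psi> by (rule differentiable_chain_at)
    then show ?thesis
      unfolding g_def o_def using inner by (intro derivative_intros) auto
  qed
  then have "g differentiable_on Q"
    by (simp add: differentiable_on_def differentiable_at_withinI)
  then have "negligible (g ` Q)"
    using \<open>negligible Q\<close> by (intro negligible_differentiable_image_negligible) auto
  moreover have "{a + s *\<^sub>R (\<psi> z - a) | s z. z \<in> T \<inter> V} \<subseteq> g ` Q"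
  proof
    fix b assume "b \<in> {a + s *\<^sub>R (\<psi> z - a) | s z. z \<in> T \<inter> V}"
    then obtain s z where sz: "b = a + s *\<^sub>R (\<psi> z - a)" "z \<in> T" "z \<in> V" by blast
    then have "b = g (z + s *\<^sub>R e)" unfolding g_def pr[OF sz(2)] by simp
    moreover have "z + s *\<^sub>R e \<in> Q" unfolding Q_def using sz by blast
    ultimately show "b \<in> g ` Q" by blast
  qed
  ultimately show ?thesis by (rule negligible_subset)
qed

text \<open>The chart definition leaves the dimension \<open>m\<close> of the frontier open. The frontier has to
separate the interior from the complement, which a submanifold of codimension two cannot do: the cone
over it from an interior point \<open>a\<close> would be negligible, so it would miss some point \<open>b\<close> outside \<open>S\<close>,
and the segment from \<open>a\<close> to \<open>b\<close> would avoid the frontier.\<close>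

lemma frontier_not_low_dimensional:
  fixes S :: "'a::euclidean_space set"
  assumes S: "compact S" "interior S \<noteq> {}"
    and charts: "\<forall>p\<in>frontier S. \<exists>U V (\<phi> :: 'a \<Rightarrow> 'a) \<psi> T.
        open U \<and> p \<in> U \<and> open V \<and> homeomorphism U V \<phi> \<psi> \<and> C1_on U \<phi> \<and> C1_on V \<psi> \<and>
        subspace T \<and> dim T = m \<and> \<phi> ` (frontier S \<inter> U) = T \<inter> V"
  shows "DIM('a) \<le> m + 1"
proof (rule ccontr)
  assume m: "\<not> ?thesis"
  obtain a where a: "a \<in> interior S" using S(2) by blast
  define cone where "cone = (\<lambda>A. {a + s *\<^sub>R (p - a) | s p. p \<in> A})"
  have local_cone: "\<exists>U. open U \<and> p \<in> U \<and> negligible (cone (frontier S \<inter> U))" if "p \<in> frontier S" for p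
  proof -
    note chart = bspec[OF charts that]
    obtain U V and \<phi> :: "'a \<Rightarrow> 'a" and \<psi> T where c: "homeomorphism U V \<phi> \<psi>" "open U" "p \<in> U" "open V" "C1_on V \<psi>"
      "subspace T" "dim T = m" "\<phi> ` (frontier S \<inter> U) = T \<inter> V"
      using chart by blast
    have "cone (frontier S \<inter> U) \<subseteq> {a + s *\<^sub>R (\<psi> z - a) | s z. z \<in> T \<inter> V}"
    proof
      fix b assume "b \<in> cone (frontier S \<inter> U)"
      then obtain s p where p: "b = a + s *\<^sub>R (p - a)" "p \<in> frontier S \<inter> U"
        unfolding cone_def by blast
      then have "\<phi> p \<in> T \<inter> V" "\<psi> (\<phi> p) = p"
        using c(1,8) by (auto simp: homeomorphism_def)
      then show "b \<in> {a + s *\<^sub>R (\<psi> z - a) | s z. z \<in> T \<inter> V}"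
        using p by (intro CollectI exI[of _ s] exI[of _ "\<phi> p"]) simp
    qed
    moreover have "negligible {a + s *\<^sub>R (\<psi> z - a) | s z. z \<in> T \<inter> V}"
      using c m by (intro negligible_cone_over_chart) auto
    ultimately have "negligible (cone (frontier S \<inter> U))" by (rule negligible_subset[rotated])
    then show ?thesis using c(2,3) by blast
  qed
  obtain U where U: "\<And>p. p \<in> frontier S \<Longrightarrow> open (U p) \<and> p \<in> U p \<and> negligible (cone (frontier S \<inter> U p))"
    using bchoice[of "frontier S" "\<lambda>p U. open U \<and> p \<in> U \<and> negligible (cone (frontier S \<inter> U))"] local_cone
    by blast
  obtain C where C: "C \<subseteq> frontier S" "finite C" "frontier S \<subseteq> (\<Union>p\<in>C. U p)"
    by (rule compactE_image[OF compact_frontier[OF S(1)], of "frontier S" U]) (use U in auto)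
  have "cone (frontier S) \<subseteq> (\<Union>p\<in>C. cone (frontier S \<inter> U p))"
    using C(3) unfolding cone_def by blast
  moreover have "negligible (\<Union>p\<in>C. cone (frontier S \<inter> U p))"
    using C U by (intro negligible_Union) auto
  ultimately have neg: "negligible (cone (frontier S))" by (rule negligible_subset[rotated])
  have "open (- S)" using S(1) by (intro open_Compl compact_imp_closed)
  moreover have "- S \<noteq> {}"
    using compact_imp_bounded[OF S(1)] not_bounded_UNIV by (metis boolean_algebra.compl_zero double_complement)
  ultimately have "\<not> negligible (- S)" by (rule open_not_negligible)
  then have "\<not> - S \<subseteq> cone (frontier S)"
    using negligible_subset[OF neg] by blast
  then obtain b where b: "b \<notin> S" "b \<notin> cone (frontier S)" by blast
  have "closed_segment a b \<inter> frontier S \<noteq> {}"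
  proof (rule connected_Int_frontier)
    show "closed_segment a b \<inter> S \<noteq> {}" using a interior_subset by blast
    show "closed_segment a b - S \<noteq> {}" using b(1) by blast
  qed simp
  then obtain p where pf: "p \<in> frontier S" "p \<in> closed_segment a b" by blast
  then obtain t where p: "p \<in> frontier S" "p = (1 - t) *\<^sub>R a + t *\<^sub>R b"
    by (auto simp: in_segment)
  have "t \<noteq> 0" using p a by (auto simp: frontier_def)
  then have "b = a + (1 / t) *\<^sub>R (p - a)"
    unfolding p(2) by (simp add: algebra_simps) 
  then show False using b(2) p(1) unfolding cone_def by blast
qed

text \<open>Along every curve \<open>t \<mapsto> \<psi> (z + t \<tau>)\<close> in the submanifold the squared distance from \<open>y\<close> is maximal at
\<open>t = 0\<close>, so its derivative vanishes there.\<close>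

lemma diametral_direction_normal_to_chart:
  fixes \<psi> :: "'a::euclidean_space \<Rightarrow> 'a"
  assumes "open V" "z \<in> V" "subspace T" "z \<in> T" "\<tau> \<in> T"
    and \<psi>': "(\<psi> has_derivative \<psi>') (at z)"
    and far: "\<And>z'. z' \<in> T \<inter> V \<Longrightarrow> dist (\<psi> z') y \<le> dist (\<psi> z) y"
  shows "(\<psi> z - y) \<bullet> \<psi>' \<tau> = 0"
proof -
  define h where "h = (\<lambda>t. (\<psi> (z + t *\<^sub>R \<tau>) - y) \<bullet> (\<psi> (z + t *\<^sub>R \<tau>) - y))"
  have "((\<lambda>t. z + t *\<^sub>R \<tau>) has_derivative (\<lambda>t. t *\<^sub>R \<tau>)) (at 0)"
    by (auto intro!: derivative_eq_intros)
  then have "((\<lambda>t. \<psi> (z + t *\<^sub>R \<tau>)) has_derivative (\<lambda>t. \<psi>' (t *\<^sub>R \<tau>))) (at 0)"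
    using has_derivative_compose[of "\<lambda>t. z + t *\<^sub>R \<tau>" _ 0 UNIV \<psi> \<psi>'] \<psi>' by simp
  then have "(h has_derivative (\<lambda>t. 2 * ((\<psi> z - y) \<bullet> \<psi>' (t *\<^sub>R \<tau>)))) (at 0)"
    unfolding h_def by (auto intro!: derivative_eq_intros simp: inner_commute)
  moreover have "\<psi>' (t *\<^sub>R \<tau>) = t *\<^sub>R \<psi>' \<tau>" for t
    using has_derivative_linear[OF \<psi>'] by (rule linear_scale)
  ultimately have deriv: "DERIV h 0 :> 2 * ((\<psi> z - y) \<bullet> \<psi>' \<tau>)"
    by (auto intro: has_derivative_imp_has_field_derivative)
  have "open ((\<lambda>t. z + t *\<^sub>R \<tau>) -` V)"
    using \<open>open V\<close> by (intro open_vimage continuous_intros)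
  then obtain e where "0 < e" and e: "\<And>t. dist t 0 < e \<Longrightarrow> z + t *\<^sub>R \<tau> \<in> V"
    using \<open>z \<in> V\<close> unfolding open_dist by (metis (no_types, lifting) add.right_neutral scaleR_zero_left vimageE vimageI)
  have "h t \<le> h 0" if "\<bar>0 - t\<bar> < e" for t
  proof -
    have "z + t *\<^sub>R \<tau> \<in> T \<inter> V"
      using e[of t] that assms by (auto intro: subspace_add subspace_scale)
    then have "(norm (\<psi> (z + t *\<^sub>R \<tau>) - y))\<^sup>2 \<le> (norm (\<psi> z - y))\<^sup>2"
      using far by (intro power_mono) (auto simp: dist_norm)
    then show ?thesis by (simp add: h_def power2_norm_eq_inner)
  qed
  then have "2 * ((\<psi> z - y) \<bullet> \<psi>' \<tau>) = 0"
    using DERIV_local_max[OF deriv \<open>0 < e\<close>] by blast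
  then show ?thesis by simp
qed

lemma parallel_if_orthogonal_to_hyperplane:
  fixes w1 w2 :: "'a::euclidean_space"
  assumes L: "DIM('a) \<le> dim L + 1" "\<And>x. x \<in> L \<Longrightarrow> w1 \<bullet> x = 0" "\<And>x. x \<in> L \<Longrightarrow> w2 \<bullet> x = 0"
    and "w1 \<noteq> 0"
  shows "\<exists>c. w2 = c *\<^sub>R w1"
proof -
  define w where "w = w2 - ((w2 \<bullet> w1) / (w1 \<bullet> w1)) *\<^sub>R w1"
  have orth: "w \<bullet> w1 = 0" using \<open>w1 \<noteq> 0\<close> by (simp add: w_def inner_diff_left)
  have "w = 0"
  proof (rule ccontr)
    assume "w \<noteq> 0"
    have "w \<bullet> x = 0" if "x \<in> L" for x using L that by (simp add: w_def inner_diff_left)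
    then have "dim ({w} \<union> ({w1} \<union> L)) = dim {w} + dim ({w1} \<union> L)"
      using orth by (intro dim_orthogonal_sum) auto
    moreover have "dim ({w1} \<union> L) = dim {w1} + dim L"
      using L by (intro dim_orthogonal_sum) auto
    ultimately have "dim ({w} \<union> ({w1} \<union> L)) = dim L + 2"
      using \<open>w \<noteq> 0\<close> \<open>w1 \<noteq> 0\<close> by (simp add: dim_insert)
    then show False using L(1) dim_subset_UNIV[of "{w} \<union> ({w1} \<union> L)"] by linarith
  qed
  then show ?thesis by (auto simp: w_def)
qed

text \<open>A point \<open>x\<close> with a partner lies on the frontier, and the direction to every partner is normal to the
tangent space at \<open>x\<close>, which has dimension at least \<open>n - 1\<close>. Two partners could then only be opposite to
each other with respect to \<open>x\<close>, and their distance would be twice the diameter.\<close>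

lemma smooth_body_unique_partner:
  fixes S :: "'a::euclidean_space set"
  assumes "smooth_body S" and d: "diameter S > 0"
    and x: "x \<in> S" and y: "y1 \<in> S" "y2 \<in> S" "dist x y1 = diameter S" "dist x y2 = diameter S"
  shows "y1 = y2"
proof -
  have hom: "S homeomorphic (cball 0 1 :: 'a set)" and C1: "C1_submanifold (frontier S)"
    using assms(1) by (auto simp: smooth_body_def)
  have S: "compact S" using homeomorphic_compactness[OF hom] by simp
  have dist_le: "dist a b \<le> diameter S" if "a \<in> S" "b \<in> S" for a b
    using diameter_bounded_bound[OF compact_imp_bounded[OF S] that] .
  have "interior S homeomorphic interior (cball 0 1 :: 'a set)"
    using hom by (rule homeomorphic_interiors_same_dimension) simp
  then have int: "interior S \<noteq> {}" by auto
  obtain m where charts: "\<forall>p\<in>frontier S. \<exists>U V (\<phi> :: 'a \<Rightarrow> 'a) \<psi> T.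
        open U \<and> p \<in> U \<and> open V \<and> homeomorphism U V \<phi> \<psi> \<and> C1_on U \<phi> \<and> C1_on V \<psi> \<and>
        subspace T \<and> dim T = m \<and> \<phi> ` (frontier S \<inter> U) = T \<inter> V"
    using C1 unfolding C1_submanifold_def by (rule exE)
  have m: "DIM('a) \<le> m + 1" by (rule frontier_not_low_dimensional[OF S int charts])
  (* From an interior point one could move further away from the partner. *)
  have "x \<notin> interior S"
  proof
    assume "x \<in> interior S"
    then obtain e where e: "0 < e" "cball x e \<subseteq> S" using mem_interior_cball by blast
    define x' where "x' = x + (e / diameter S) *\<^sub>R (x - y1)"
    have "norm (x - y1) = diameter S" using y(3) by (simp add: dist_norm)
    then have "dist x x' = e" using e(1) d by (simp add: x'_def dist_norm)
    then have "x' \<in> S" using e(2) by auto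
    have "x' - y1 = (1 + e / diameter S) *\<^sub>R (x - y1)" by (simp add: x'_def algebra_simps)
    then have "dist x' y1 = (1 + e / diameter S) * diameter S"
      using e(1) d y(3) by (simp add: dist_norm)
    also have "\<dots> = diameter S + e" using d by (simp add: field_simps)
    finally show False using dist_le[OF \<open>x' \<in> S\<close> y(1)] e(1) by simp
  qed
  then have xf: "x \<in> frontier S" using x closure_subset by (auto simp: frontier_def)
  obtain U V and \<phi> :: "'a \<Rightarrow> 'a" and \<psi> T where c: "homeomorphism U V \<phi> \<psi>" "open U" "x \<in> U" "open V" "C1_on U \<phi>" "C1_on V \<psi>"
      "subspace T" "dim T = m" "\<phi> ` (frontier S \<inter> U) = T \<inter> V"
    using bspec[OF charts xf] by blast
  define z where "z = \<phi> x"
  have z: "z \<in> T" "z \<in> V" "\<psi> z = x"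
    using c(1,3,9) xf by (auto simp: z_def homeomorphism_def)
  obtain \<psi>' where \<psi>': "(\<psi> has_derivative \<psi>') (at z)"
    using c(6) z(2) by (auto simp: C1_on_def)
  obtain \<phi>' where \<phi>': "(\<phi> has_derivative \<phi>') (at x)"
    using c(5) c(3) by (auto simp: C1_on_def)
  have "((\<lambda>z. \<phi> (\<psi> z)) has_derivative (\<lambda>t. \<phi>' (\<psi>' t))) (at z)"
    using has_derivative_compose[OF \<psi>'] \<phi>' z(3) by simp
  then have "((\<lambda>z. z) has_derivative (\<lambda>t. \<phi>' (\<psi>' t))) (at z)"
    by (rule has_derivative_transform_within_open[OF _ c(4) z(2)]) (use c(1) in \<open>simp add: homeomorphism_def\<close>)
  then have "(\<lambda>t. \<phi>' (\<psi>' t)) = (\<lambda>t. t)"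
    using has_derivative_unique[OF _ has_derivative_ident] by blast
  then have "inj \<psi>'" by (metis injI)
  then have "dim (\<psi>' ` T) = m"
    using c(8) has_derivative_linear[OF \<psi>'] by (subst dim_image_eq) (auto intro: inj_on_subset)
  moreover have "(x - y) \<bullet> t = 0" if "y \<in> S" "dist x y = diameter S" "t \<in> \<psi>' ` T" for y t
  proof -
    have "\<psi> z' \<in> S" if "z' \<in> T \<inter> V" for z'
    proof -
      have "z' \<in> \<phi> ` (frontier S \<inter> U)" using that c(9) by simp
      then have "\<psi> z' \<in> frontier S" using c(1) by (auto simp: homeomorphism_def)
      then show ?thesis using frontier_subset_compact[OF S] by blast
    qed
    then have "(\<psi> z - y) \<bullet> \<psi>' \<tau> = 0" if "\<tau> \<in> T" for \<tau>
      using c z that \<psi>' dist_le \<open>y \<in> S\<close> \<open>dist x y = diameter S\<close>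
      by (intro diametral_direction_normal_to_chart[of V z T]) auto
    then show ?thesis using that(3) z(3) by auto
  qed
  moreover have "x - y1 \<noteq> 0" using y(3) d by auto
  ultimately obtain l where l: "x - y2 = l *\<^sub>R (x - y1)"
    using parallel_if_orthogonal_to_hyperplane[of "\<psi>' ` T" "x - y1" "x - y2"] m y by metis
  have "\<bar>l\<bar> = 1"
    using arg_cong[OF l, of norm] y(3,4) d by (simp add: dist_norm)
  moreover have "l \<noteq> - 1"
  proof
    assume "l = - 1"
    then have "y2 - y1 = 2 *\<^sub>R (x - y1)" using l by (simp add: algebra_simps scaleR_2)
    then have "dist y2 y1 = 2 * diameter S" using y(3) by (simp add: dist_norm)
    then show False using dist_le[OF y(2,1)] d by simp
  qed
  ultimately have "l = 1" by linarith
  then show ?thesis using l by simp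
qed

text \<open>The set lies in a ball of radius half its diameter around the center, in which only opposite points
are at distance the diameter, by the parallelogram law. The closure appears because \<open>S\<close> need not
be closed.\<close>

lemma centrally_symmetric_unique_partner:
  fixes S :: "'a::real_inner set"
  assumes S: "bounded S" "centrally_symmetric S"
    and xyz: "x \<in> closure S" "y \<in> closure S" "z \<in> closure S" "dist x y = diameter S" "dist x z = diameter S"
  shows "y = z"
proof -
  obtain c where c: "(\<lambda>x. 2 *\<^sub>R c - x) ` S = S"
    using S(2) by (auto simp: centrally_symmetric_def)
  have half: "norm (a - c) \<le> diameter S / 2" if "a \<in> closure S" for a
  proof -
    have "norm (a - c) \<le> diameter S / 2" if "a \<in> S" for a
    proof -
      have "2 *\<^sub>R c - a \<in> S" using c that by blast
      then have "dist a (2 *\<^sub>R c - a) \<le> diameter S"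
        using that S(1) by (intro diameter_bounded_bound)
      moreover have "a - (2 *\<^sub>R c - a) = 2 *\<^sub>R (a - c)" by (simp add: algebra_simps scaleR_2)
      ultimately show ?thesis by (simp add: dist_norm)
    qed
    then have "S \<subseteq> cball c (diameter S / 2)" by (auto simp: dist_norm norm_minus_commute)
    then have "closure S \<subseteq> cball c (diameter S / 2)" by (rule closure_minimal) simp
    then show ?thesis using that by (auto simp: dist_norm norm_minus_commute)
  qed
  have "b - c = - (x - c)" if "b \<in> closure S" "dist x b = diameter S" for b
  proof -
    let ?p = "x - c" and ?q = "b - c"
    have "(norm (?p + ?q))\<^sup>2 = 2 * (norm ?p)\<^sup>2 + 2 * (norm ?q)\<^sup>2 - (norm (?p - ?q))\<^sup>2"
      unfolding power2_norm_eq_inner by (simp add: inner_add_left inner_add_right inner_diff_left inner_diff_right)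
    moreover have "norm (?p - ?q) = diameter S" using that(2) by (simp add: dist_norm)
    moreover have "(norm ?p)\<^sup>2 \<le> (diameter S / 2)\<^sup>2" "(norm ?q)\<^sup>2 \<le> (diameter S / 2)\<^sup>2"
      using half xyz(1) that(1) by (auto intro!: power_mono)
    ultimately have "(norm (?p + ?q))\<^sup>2 \<le> 0" by (simp add: power_divide)
    then have "?p + ?q = 0" by simp
    then show ?thesis by (simp add: add_eq_0_iff)
  qed
  from this[OF xyz(2,4)] this[OF xyz(3,5)] have "y - c = z - c" by simp
  then show ?thesis by simp
qed

section \<open>Multifold Borsuk numbers\<close>

lemma borsuk_number_le:
  assumes "0 < m" "k_fold_cover k S m F" "\<And>i. i < m \<Longrightarrow> bounded (F i) \<and> diameter (F i) < diameter S"
  shows "borsuk_number k S \<le> m"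
  unfolding borsuk_number_def using assms by (intro Least_le) blast

text \<open>The least number in the definition of \<open>borsuk_number\<close> is meaningful only if some cover exists: take \<open>k\<close> copies of a finite
cover by small balls, with the ball of index \<open>i\<close> depending on \<open>i mod n\<close>.\<close>

lemma small_k_fold_cover_exists:
  fixes S :: "'a::euclidean_space set"
  assumes S: "bounded S" "diameter S > 0" and "0 < k"
  shows "\<exists>m. 0 < m \<and> (\<exists>F. k_fold_cover k S m F \<and> (\<forall>i<m. bounded (F i) \<and> diameter (F i) < diameter S))"
proof -
  let ?d = "diameter S"
  have "compact (closure S)" using S(1) by (simp add: compact_closure)
  then obtain C where C: "finite C" "closure S \<subseteq> (\<Union>c\<in>C. ball c (?d / 4))"
  proof (rule compactE_image[of _ "closure S" "\<lambda>c. ball c (?d / 4)"])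
    show "closure S \<subseteq> (\<Union>c\<in>closure S. ball c (?d / 4))" using S(2) by force
  qed auto
  define n where "n = card C"
  have "S \<noteq> {}" using S(2) by (auto simp: diameter_def)
  then have "C \<noteq> {}" using C(2) closure_subset by fastforce
  then have "0 < n" using C(1) by (simp add: n_def card_gt_0_iff)
  obtain c where c: "bij_betw c {0..<n} C"
    using ex_bij_betw_nat_finite[OF C(1)] by (auto simp: n_def)
  define F where "F = (\<lambda>i. ball (c (i mod n)) (?d / 4))"
  have "diameter (F i) < ?d" for i
  proof -
    have "dist x y \<le> ?d / 2" if "x \<in> F i" "y \<in> F i" for x y
      using that dist_triangle[of x y "c (i mod n)"] by (simp add: F_def dist_commute)
    then have "diameter (F i) \<le> ?d / 2"
      using S(2) by (intro diameter_le) (auto simp: dist_norm)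
    then show ?thesis using S(2) by simp
  qed
  moreover have "k_fold_cover k S (k * n) F"
    unfolding k_fold_cover_def
  proof
    fix x assume "x \<in> S"
    then obtain b where "b \<in> C" "x \<in> ball b (?d / 4)" using C(2) closure_subset by blast
    then obtain j where j: "j < n" "x \<in> ball (c j) (?d / 4)"
      using c by (metis atLeastLessThan_iff bij_betw_iff_bijections)
    have "(\<lambda>q. j + n * q) ` {..<k} \<subseteq> {i \<in> {..<k * n}. x \<in> F i}"
    proof
      fix i assume "i \<in> (\<lambda>q. j + n * q) ` {..<k}"
      then obtain q where q: "q < k" "i = j + n * q" by auto
      have "i < n * Suc q" using j(1) q(2) by simp
      also have "\<dots> \<le> n * k" using q(1) by (intro mult_le_mono2) simp
      finally show "i \<in> {i \<in> {..<k * n}. x \<in> F i}"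
        using q j by (simp add: F_def mult.commute)
    qed
    then have "card ((\<lambda>q. j + n * q) ` {..<k}) \<le> card {i \<in> {..<k * n}. x \<in> F i}"
      by (intro card_mono) auto
    moreover have "inj_on (\<lambda>q. j + n * q) {..<k}" using \<open>0 < n\<close> by (simp add: inj_on_def)
    ultimately show "k \<le> card {i \<in> {..<k * n}. x \<in> F i}" by (simp add: card_image)
  qed
  ultimately show ?thesis
    using \<open>0 < n\<close> \<open>0 < k\<close> by (intro exI[of _ "k * n"] conjI exI[of _ F]) (auto simp: F_def)
qed

lemma borsuk_number_ge:
  fixes S :: "'a::euclidean_space set"
  assumes "bounded S" "diameter S > 0" "0 < k"
    and lower: "\<And>m F. \<lbrakk>k_fold_cover k S m F; \<And>i. i < m \<Longrightarrow> bounded (F i) \<and> diameter (F i) < diameter S\<rbrakk> \<Longrightarrow> n \<le> m"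
  shows "n \<le> borsuk_number k S"
  using LeastI_ex[OF small_k_fold_cover_exists[OF assms(1-3)]] lower
  unfolding borsuk_number_def by blast

lemma borsuk_number_unique_partner_le:
  fixes S :: "'a::euclidean_space set"
  assumes S: "bounded S" "diameter S > 0" and "0 < k"
    and unique: "\<And>x y z. \<lbrakk>x \<in> closure S; y \<in> closure S; z \<in> closure S;
        dist x y = diameter S; dist x z = diameter S\<rbrakk> \<Longrightarrow> y = z"
  shows "borsuk_number k S \<le> 2 * k + DIM('a) - 1"
proof -
  let ?m = "2 * k + DIM('a) - 1"
  obtain F where F: "k_fold_cover k (closure S) ?m F"
    "\<forall>i<?m. bounded (F i) \<and> diameter (F i) < diameter S"
    using unique_partner_cover[of "closure S" k] S unique \<open>0 < k\<close>
    by (auto simp: compact_closure diameter_closure)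
  then have "k_fold_cover k S ?m F"
    using closure_subset by (auto simp: k_fold_cover_def)
  then show ?thesis
    using F(2) \<open>0 < k\<close> by (intro borsuk_number_le[where F=F]) auto
qed

lemma borsuk_number_le_of_smooth_or_symmetric:
  fixes S :: "'a::euclidean_space set"
  assumes S: "bounded S" "diameter S > 0" and "0 < k" and "smooth_body S \<or> centrally_symmetric S"
  shows "borsuk_number k S \<le> 2 * k + DIM('a) - 1"
  using assms(4)
proof
  assume sm: "smooth_body S"
  then have "closed S"
    using homeomorphic_compactness compact_imp_closed compact_cball by (metis smooth_body_def)
  then show ?thesis
    using S \<open>0 < k\<close> smooth_body_unique_partner[OF sm S(2)]
    by (intro borsuk_number_unique_partner_le) auto
next
  assume "centrally_symmetric S"
  then show ?thesis
    using S \<open>0 < k\<close> centrally_symmetric_unique_partner[OF S(1)]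
    by (intro borsuk_number_unique_partner_le) blast+
qed

text \<open>The unit ball is centrally symmetric, and the identity map of its boundary sphere carries antipodal
points to points at distance its diameter \<open>2\<close>.\<close>

lemma borsuk_number_unit_ball:
  assumes "0 < k"
  shows "borsuk_number k (cball 0 1 :: 'a::euclidean_space set) = 2 * k + DIM('a) - 1"
proof (rule antisym)
  let ?B = "cball 0 1 :: 'a set"
  have d: "diameter ?B = 2" by (simp add: diameter_cball)
  have "(\<lambda>x. 2 *\<^sub>R 0 - x) ` ?B = ?B" by (auto simp: image_iff intro!: bexI[of _ "- _"])
  then have "centrally_symmetric ?B" unfolding centrally_symmetric_def by blast
  then show "borsuk_number k ?B \<le> 2 * k + DIM('a) - 1"
    using d assms by (intro borsuk_number_le_of_smooth_or_symmetric) auto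
  show "2 * k + DIM('a) - 1 \<le> borsuk_number k ?B"
  proof (rule borsuk_number_ge)
    fix m F
    assume F: "k_fold_cover k ?B m F" "\<And>i. i < m \<Longrightarrow> bounded (F i) \<and> diameter (F i) < diameter ?B"
    show "2 * k + DIM('a) - 1 \<le> m"
    proof (rule multifold_lusternik_schnirelmann[OF assms _ _ _ F])
      show "diameter ?B \<le> dist (id u) (id (- u))" if "norm u = 1" for u :: 'a
      proof -
        have "u - - u = 2 *\<^sub>R u" by (simp add: scaleR_2)
        then show ?thesis using that by (simp add: d dist_norm)
      qed
    qed (auto intro: continuous_on_id)
  qed (use d assms in auto)
qed

lemma borsuk_number_constant_width_ge:
  fixes S :: "'a::euclidean_space set"
  assumes S: "bounded S" "diameter S > 0" and "0 < k" and cw: "convex_body S" "constant_width S"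
  shows "2 * k + DIM('a) - 1 \<le> borsuk_number k S"
proof (rule borsuk_number_ge)
  fix m F
  assume F: "k_fold_cover k S m F" "\<And>i. i < m \<Longrightarrow> bounded (F i) \<and> diameter (F i) < diameter S"
  obtain p :: "'a \<Rightarrow> 'a" where "continuous_on (sphere 0 1) p" "p ` sphere 0 1 \<subseteq> S"
    "\<And>u. norm u = 1 \<Longrightarrow> dist (p u) (p (- u)) = diameter S"
    using constant_width_support_points[OF cw] by blast
  then show "2 * k + DIM('a) - 1 \<le> m"
    using F \<open>0 < k\<close> by (intro multifold_lusternik_schnirelmann[where p=p and S=S and F=F and d="diameter S"]) auto
qed (use assms in auto)

theorem theorem4:
  fixes S :: "(real ^ 'n) set"
  assumes "bounded S" and "diameter S > 0"
  shows
    "(smooth_body S \<or> centrally_symmetric S \<longrightarrow>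
        (\<forall>k>0. borsuk_number k S \<le> borsuk_number k (cball 0 1 :: (real ^ 'n) set))) \<and>
     (convex_body S \<and> constant_width S \<longrightarrow>
        (\<forall>k>0. borsuk_number k S \<ge> borsuk_number k (cball 0 1 :: (real ^ 'n) set))) \<and>
     (\<forall>k>0. borsuk_number k (cball 0 1 :: (real ^ 'n) set) = 2 * k + CARD('n) - 1)"
  using borsuk_number_le_of_smooth_or_symmetric[OF assms] borsuk_number_constant_width_ge[OF assms]
    borsuk_number_unit_ball[where 'a="real ^ 'n"]
  by simp

end
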